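(* In the setting of the stochastic APP algorithm described in the context, assume: (a) (linearly bounded subgradients) there exist $c_1,c_2>0$ such that $\|r\|_\star\le c_1\|u\|+c_2$ for all $(u,w)\in U^{\mathrm{ad}}\times\mathbb{W}$ and all $r\in\partial_u j^{C}(u,w)$, and there exist $d_1,d_2>0$ such that $\|s\|_\star\le d_1\|u\|+d_2$ for all $(u,w)\in U^{\mathrm{ad}}\times\mathbb{W}$ and all $s\in\partial_u j^{\Sigma}(u,w)$; (b) $J$ is coercive on $U^{\mathrm{ad}}$; (c) $K$ is $b$-strongly convex for some $b>0$, i.e. $K(v)\ge K(u)+\langle\nabla K(u),v-u\rangle+\frac b2\|u-v\|^2$ for all $u,v\in\mathbb{U}$, and $\nabla K$ is $L_K$-Lipschitz for some $L_K>0$, i.e. $\|\nabla K(v)-\nabla K(u)\|_\star\le L_K\|v-u\|$ for all $u,v\in\mathbb{U}$; (d) $\varepsilon_k>0$ for all $k$, $\sum_k\varepsilon_k=+\infty$ and $\sum_k\varepsilon_k^2<+\infty$; (e) each $\mathbf{R}_k$ is $\mathcal{F}_{k+1}$-measurable, the sequence $\{\mathbf{R}_k\}_{k\in\mathbb{N}}$ is $\mathbb{P}$-almost surely bounded, and $\sum_{k\in\mathbb{N}}\varepsilon_k\,\mathbb{E}\big(\|\mathbf{R}_k\|_\star\mid\mathcal{F}_k\big)<+\infty$ $\mathbb{P}$-almost surely; (f) for every integer $k\ge1$ there is an integrable $\psi_k:\Omega\to\mathbb{R}$ such that $\psi_k(\cdot)\le(j^{C}+j^{\Sigma})(u,\mathbf{W}_k(\cdot))$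 for all $u\in\mathbb{U}$; (g) with $Q_k=\operatorname{ess\,sup}_{\omega\in\Omega}\|\mathbf{R}_k(\omega)\|_\star$, one has $\sum_{k\in\mathbb{N}}Q_k\varepsilon_k<\infty$. Suppose that for all $k\ge1$, $\varepsilon_k=ck^{-\theta}$ with $1/2<\theta<1$ and a constant $c>0$, and that $Q_k\le qk^{-\nu}$ with $\nu>1-\theta$ and a constant $q>0$. Then, for any minimizer $u^\sharp$ of $J$ over $U^{\mathrm{ad}}$, $$\mathbb{E}\big(J(\mathbf{U}_n)-J(u^\sharp)\big)=\mathcal{O}(n^{\theta-1})\quad\text{as }n\to\infty.$$ In particular, the rate of convergence can be made arbitrarily close to the order $n^{-1/2}$ by choosing $\theta$ arbitrarily close to $1/2$.
   Context: Setting. $\mathbb{U}$ is a reflexive separable Banach space with norm $\|\cdot\|$, dual $\mathbb{U}^\star$, dual norm $\|\cdot\|_\star$, duality pairing $\langle\cdot,\cdot\rangle$; $(\Omega,\mathcal{A},\mathbb{P})$ is a probability space with $\mathcal{A}$ complete for $\mathbb{P}$; $\mathbb{W}$ is a topological vector space with its Borel $\sigma$-field; $U^{\mathrm{ad}}\subset\mathbb{U}$ is non-empty, closed, convex. $j^{C},j^{\Sigma}:\mathbb{U}\times\mathbb{W}\to\mathbb{R}$ are jointly lower semicontinuous; for all $w$, $j^{C}(\cdot,w)$ and $j^{\Sigma}(\cdot,w)$ are proper and convex, and $j^{C}(\cdot,w)$ is subdifferentiable on an open set containing $U^{\mathrm{ad}}$. $K:\mathbb{U}\to\mathbb{R}$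 is convex, lower semicontinuous and Gateaux-differentiable (on an open set containing $U^{\mathrm{ad}}$, and everywhere where $\nabla K$ is used). $\mathbf{W}:\Omega\to\mathbb{W}$ is a random variable, $J^{C}(u)=\mathbb{E}(j^{C}(u,\mathbf{W}))$, $J^{\Sigma}(u)=\mathbb{E}(j^{\Sigma}(u,\mathbf{W}))$, $J=J^{C}+J^{\Sigma}$; these expectations are understood to be well defined, with $J$ finite on $U^{\mathrm{ad}}$. The problem is $\min_{u\in U^{\mathrm{ad}}}J(u)$ (its solution set is non-empty under coercivity of $J$). A function is coercive on $U^{\mathrm{ad}}$ if it tends to $+\infty$ when $\|u\|\to+\infty$, $u\in U^{\mathrm{ad}}$. Algorithm. $\mathbf{W}_1,\mathbf{W}_2,\ldots$ are independent random variables distributed as $\mathbf{W}$, $\mathcal{F}_k=\sigma(\mathbf{W}_1,\ldots,\mathbf{W}_k)$; $\varepsilon_k>0$ are step sizes; $\mathbf{R}_k:\Omega\to\mathbb{U}^\star$ are measurable (additive errors). $\mathbf{U}_0\equiv u_0\in U^{\mathrm{ad}}$ and, for $k\in\mathbb{N}$, $\mathbf{G}_k:\Omega\to\mathbb{U}^\star$ is measurable with $\mathbf{G}_k(\omega)\in\partial_u j^{C}(\mathbf{U}_k(\omega),\mathbf{W}_{k+1}(\omega))$ for all $\omega$, and $\mathbf{U}_{k+1}(\omega)$ is the unique (as $K$ is strongly convex) minimizer over $u\in U^{\mathrm{ad}}$ of $$K(u)+\big\langle\varepsilon_k(\mathbf{G}_k(\omega)+\mathbf{R}_k(\omega))-\nabla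 K(\mathbf{U}_k(\omega)),u\big\rangle+\varepsilon_k\,j^{\Sigma}(u,\mathbf{W}_{k+1}(\omega)),$$ this function being coercive on $U^{\mathrm{ad}}$ for all $k$ and $\omega$. The iterates are adapted: $\mathbf{U}_k$ is $\mathcal{F}_k$-measurable for all $k$. *)

theory Defs
  imports "HOL-Probability.Probability" "HOL-Library.Landau_Symbols"
begin

section \<open>Convex analysis on a normed space and its dual\<close>

text \<open>The topological dual of \<^typ>\<open>'u\<close> is \<^typ>\<open>'u \<Rightarrow>\<^sub>L real\<close>; its norm is the operator norm and the
  duality pairing is \<^const>\<open>blinfun_apply\<close>.\<close>

text \<open>Every element of the bidual is the evaluation at some point.\<close>

definition reflexive_space :: "'u::real_normed_vector itself \<Rightarrow> bool" where
  "reflexive_space _ \<longleftrightarrow>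
     (\<forall>\<phi> :: ('u \<Rightarrow>\<^sub>L real) \<Rightarrow>\<^sub>L real. \<exists>u. \<forall>l. blinfun_apply \<phi> l = blinfun_apply l u)"

definition lsc :: "('x::topological_space \<Rightarrow> real) \<Rightarrow> bool" where
  "lsc f \<longleftrightarrow> (\<forall>a. open {x. a < f x})"

definition subdifferential ::
    "('u::real_normed_vector \<Rightarrow> real) \<Rightarrow> 'u \<Rightarrow> ('u \<Rightarrow>\<^sub>L real) set" where
  "subdifferential f u = {r. \<forall>v. f v \<ge> f u + blinfun_apply r (v - u)}"

definition has_gateaux_gradient ::
    "('u::real_normed_vector \<Rightarrow> real) \<Rightarrow> ('u \<Rightarrow>\<^sub>L real) \<Rightarrow> 'u \<Rightarrow> bool" where
  "has_gateaux_gradient f g u \<longleftrightarrow>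
     (\<forall>h. ((\<lambda>t. (f (u + t *\<^sub>R h) - f u) / t) \<longlongrightarrow> blinfun_apply g h) (at 0))"

text \<open>The filter below describes \<open>norm u \<rightarrow> \<infinity>\<close> with \<open>u \<in> S\<close>.\<close>

definition coercive_on :: "'u::real_normed_vector set \<Rightarrow> ('u \<Rightarrow> real) \<Rightarrow> bool" where
  "coercive_on S f \<longleftrightarrow> filterlim f at_top (inf at_infinity (principal S))"


section \<open>The stochastic optimization problem\<close>

text \<open>Only used at points \<open>u\<close> of the feasible set, where both integrands are assumed integrable.\<close>

definition expected_cost ::
    "'a measure \<Rightarrow> ('u \<Rightarrow> 'w \<Rightarrow> real) \<Rightarrow> ('u \<Rightarrow> 'w \<Rightarrow> real) \<Rightarrow> ('a \<Rightarrow> 'w) \<Rightarrow> 'u \<Rightarrow> real" where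
  "expected_cost P jC jS W u = (\<integral>\<omega>. jC u (W \<omega>) \<partial>P) + (\<integral>\<omega>. jS u (W \<omega>) \<partial>P)"

text \<open>Separability of \<open>\<U>\<close> is the sort \<^class>\<open>second_countable_topology\<close> (equivalent to separability for
  metric spaces); that \<open>\<W>\<close> is a topological vector space is the sort of \<open>'w\<close> together with
  \<open>continuous_scaleR\<close>. The integrands are real-valued, hence automatically proper.
  \<open>gradK\<close> is the Gateaux gradient of \<open>K\<close>.\<close>

locale app_problem = prob_space P + complete_measure P
  for P :: "'a measure" +
  fixes Uad :: "'u::{banach, second_countable_topology} set"
    and jC jS :: "'u \<Rightarrow> 'w::{topological_ab_group_add, real_vector} \<Rightarrow> real"
    and K :: "'u \<Rightarrow> real"
    and gradK :: "'u \<Rightarrow> ('u \<Rightarrow>\<^sub>L real)"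
    and W :: "'a \<Rightarrow> 'w"
  assumes reflexive: "reflexive_space TYPE('u)"
    and continuous_scaleR: "continuous_on UNIV (\<lambda>(a::real, w::'w). a *\<^sub>R w)"
    and Uad_nonempty: "Uad \<noteq> {}"
    and Uad_closed: "closed Uad"
    and Uad_convex: "convex Uad"
    and jC_lsc: "lsc (\<lambda>(u, w). jC u w)"
    and jS_lsc: "lsc (\<lambda>(u, w). jS u w)"
    and jC_convex: "\<And>w. convex_on UNIV (\<lambda>u. jC u w)"
    and jS_convex: "\<And>w. convex_on UNIV (\<lambda>u. jS u w)"
    and jC_subdifferentiable:
      "\<And>w. \<exists>V. open V \<and> Uad \<subseteq> V \<and> (\<forall>u\<in>V. subdifferential (\<lambda>v. jC v w) u \<noteq> {})"
    and K_convex: "convex_on UNIV K"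
    and K_lsc: "lsc K"
    and K_gradient: "\<And>u. has_gateaux_gradient K (gradK u) u"
    and W_measurable: "W \<in> borel_measurable P"
    and jC_integrable: "\<And>u. u \<in> Uad \<Longrightarrow> integrable P (\<lambda>\<omega>. jC u (W \<omega>))"
    and jS_integrable: "\<And>u. u \<in> Uad \<Longrightarrow> integrable P (\<lambda>\<omega>. jS u (W \<omega>))"


section \<open>The stochastic APP algorithm\<close>

text \<open>\<open>\<F>\<^sub>k = \<sigma>(W\<^sub>1, \<dots>, W\<^sub>k)\<close>; for \<open>k = 0\<close> this is the trivial \<open>\<sigma>\<close>-field.\<close>

definition past :: "'a measure \<Rightarrow> (nat \<Rightarrow> 'a \<Rightarrow> 'w::topological_space) \<Rightarrow> nat \<Rightarrow> 'a measure" where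
  "past P Ws k =
     sigma (space P) (\<Union>i\<in>{1..k}. {Ws i -` A \<inter> space P |A. A \<in> sets borel})"

definition auxiliary_objective ::
    "('u::real_normed_vector \<Rightarrow> 'w \<Rightarrow> real) \<Rightarrow> ('u \<Rightarrow> real) \<Rightarrow> ('u \<Rightarrow> ('u \<Rightarrow>\<^sub>L real)) \<Rightarrow>
     real \<Rightarrow> ('u \<Rightarrow>\<^sub>L real) \<Rightarrow> 'u \<Rightarrow> 'w \<Rightarrow> 'u \<Rightarrow> real" where
  "auxiliary_objective jS K gradK e d u w v =
     K v + blinfun_apply (e *\<^sub>R d - gradK u) v + e * jS v w"

text \<open>The samples are \<open>Ws 1, Ws 2, \<dots>\<close>; \<open>Ws 0\<close> is never used.\<close>

locale app_algorithm = app_problem P Uad jC jS K gradK W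
  for P :: "'a measure"
    and Uad :: "'u::{banach, second_countable_topology} set"
    and jC jS :: "'u \<Rightarrow> 'w::{topological_ab_group_add, real_vector} \<Rightarrow> real"
    and K :: "'u \<Rightarrow> real"
    and gradK :: "'u \<Rightarrow> ('u \<Rightarrow>\<^sub>L real)"
    and W :: "'a \<Rightarrow> 'w" +
  fixes Ws :: "nat \<Rightarrow> 'a \<Rightarrow> 'w"
    and eps :: "nat \<Rightarrow> real"
    and R :: "nat \<Rightarrow> 'a \<Rightarrow> ('u \<Rightarrow>\<^sub>L real)"
    and u0 :: 'u
    and G :: "nat \<Rightarrow> 'a \<Rightarrow> ('u \<Rightarrow>\<^sub>L real)"
    and U :: "nat \<Rightarrow> 'a \<Rightarrow> 'u"
  assumes samples_indep: "indep_vars (\<lambda>_. borel) Ws {1..}"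
    and samples_distr: "\<And>k. k \<ge> 1 \<Longrightarrow> distr P borel (Ws k) = distr P borel W"
    and eps_pos: "\<And>k. eps k > 0"
    and R_measurable: "\<And>k. R k \<in> borel_measurable P"
    and u0_feasible: "u0 \<in> Uad"
    and U_init: "\<And>\<omega>. \<omega> \<in> space P \<Longrightarrow> U 0 \<omega> = u0"
    and G_measurable: "\<And>k. G k \<in> borel_measurable P"
    and G_subgradient: "\<And>k \<omega>. \<omega> \<in> space P \<Longrightarrow>
      G k \<omega> \<in> subdifferential (\<lambda>u. jC u (Ws (Suc k) \<omega>)) (U k \<omega>)"
    and auxiliary_coercive: "\<And>k \<omega>. \<omega> \<in> space P \<Longrightarrow>
      coercive_on Uad
        (auxiliary_objective jS K gradK (eps k) (G k \<omega> + R k \<omega>) (U k \<omega>) (Ws (Suc k) \<omega>))"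
    and U_step: "\<And>k \<omega>. \<omega> \<in> space P \<Longrightarrow>
      is_arg_min
        (auxiliary_objective jS K gradK (eps k) (G k \<omega> + R k \<omega>) (U k \<omega>) (Ws (Suc k) \<omega>))
        (\<lambda>u. u \<in> Uad) (U (Suc k) \<omega>)"
    and U_adapted: "\<And>k. U k \<in> borel_measurable (past P Ws k)"

text \<open>The essential supremum and the conditional expectation of the dual norm of the errors are taken
  in \<^typ>\<open>ennreal\<close>, so that infinite values are not collapsed.\<close>

definition error_sup :: "'a measure \<Rightarrow> (nat \<Rightarrow> 'a \<Rightarrow> 'b::real_normed_vector) \<Rightarrow> nat \<Rightarrow> ennreal" where
  "error_sup P R k = esssup P (\<lambda>\<omega>. ennreal (norm (R k \<omega>)))"

locale app_convergent_run = app_algorithm P Uad jC jS K gradK W Ws eps R u0 G U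
  for P :: "'a measure"
    and Uad :: "'u::{banach, second_countable_topology} set"
    and jC jS :: "'u \<Rightarrow> 'w::{topological_ab_group_add, real_vector} \<Rightarrow> real"
    and K :: "'u \<Rightarrow> real"
    and gradK :: "'u \<Rightarrow> ('u \<Rightarrow>\<^sub>L real)"
    and W :: "'a \<Rightarrow> 'w"
    and Ws :: "nat \<Rightarrow> 'a \<Rightarrow> 'w"
    and eps :: "nat \<Rightarrow> real"
    and R :: "nat \<Rightarrow> 'a \<Rightarrow> ('u \<Rightarrow>\<^sub>L real)"
    and u0 :: 'u
    and G :: "nat \<Rightarrow> 'a \<Rightarrow> ('u \<Rightarrow>\<^sub>L real)"
    and U :: "nat \<Rightarrow> 'a \<Rightarrow> 'u" +
  assumes eps_divergent: "(\<Sum>k. ennreal (eps k)) = \<infinity>"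
    and eps_square_summable: "summable (\<lambda>k. (eps k)\<^sup>2)"
    and R_adapted: "\<And>k. R k \<in> borel_measurable (past P Ws (Suc k))"
    and R_bounded: "AE \<omega> in P. bounded (range (\<lambda>k. R k \<omega>))"
    and R_cond_summable: "AE \<omega> in P.
      (\<Sum>k. ennreal (eps k) *
         nn_cond_exp P (past P Ws k) (\<lambda>\<omega>'. ennreal (norm (R k \<omega>'))) \<omega>) < \<infinity>"
    and integrable_minorant: "\<And>k. k \<ge> 1 \<Longrightarrow>
      \<exists>\<psi>::'a \<Rightarrow> real. integrable P \<psi> \<and>
        (\<forall>u. \<forall>\<omega>\<in>space P. \<psi> \<omega> \<le> jC u (Ws k \<omega>) + jS u (Ws k \<omega>))"
    and error_sup_summable: "(\<Sum>k. error_sup P R k * ennreal (eps k)) < \<infinity>"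

definition polynomial_steps_and_errors ::
    "'a measure \<Rightarrow> (nat \<Rightarrow> real) \<Rightarrow> (nat \<Rightarrow> 'a \<Rightarrow> 'b::real_normed_vector) \<Rightarrow> real \<Rightarrow> bool" where
  "polynomial_steps_and_errors P eps R \<theta> \<longleftrightarrow>
     (\<exists>c>0. \<forall>k\<ge>1. eps k = c * real k powr (- \<theta>)) \<and>
     (\<exists>q>0. \<exists>\<nu>>1 - \<theta>. \<forall>k\<ge>1. error_sup P R k \<le> ennreal (q * real k powr (- \<nu>)))"

end

theory Submission
  imports Defs
begin

text \<open>
  Three ingredients give the rate for the last iterate.

  \<^item> \<^emph>\<open>One step of the algorithm.\<close> Let \<open>D v u\<close> be the Bregman divergence of \<open>K\<close>. Strong convexity and the
    Lipschitz gradient make it comparable to \<open>(norm (v - u))\<^sup>2\<close>. The variational inequality that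
    characterizes \<open>U\<^sub>k\<^sub>+\<^sub>1\<close>, the subgradient inequalities and Young's inequality bound
    \<open>D v U\<^sub>k\<^sub>+\<^sub>1 - D v U\<^sub>k\<close> by \<open>- \<epsilon>\<^sub>k (j U\<^sub>k - j v)\<close> plus an error of order \<open>\<epsilon>\<^sub>k Q\<^sub>k + \<epsilon>\<^sub>k\<^sup>2 + (\<epsilon>\<^sub>k Q\<^sub>k)\<^sup>2\<close>, up to a
    factor that is quadratic in the points \<open>v\<close> and \<open>U\<^sub>k\<close>
    (\<open>auxiliary_step\<close>, \<open>pathwise_step\<close>). The part of the error that comes from \<open>j\<^sup>\<Sigma>\<close> is controlled by a
    subgradient of \<open>j\<^sup>\<Sigma>\<close> at \<open>U\<^sub>k\<close>. Such a subgradient exists because a real-valued convex lower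
    semicontinuous function on a Banach space is subdifferentiable everywhere
    (\<open>convex_lsc_subdifferentiable\<close>, from Baire and Hahn-Banach).

  \<^item> \<^emph>\<open>Expectations.\<close> The reference point \<open>v\<close> may be any random point that depends only on the first \<open>k\<close>
    samples. The next sample is independent of these, so Fubini's theorem replaces \<open>j\<close> by \<open>J\<close> under the
    expectation (\<open>expected_increment\<close>). With \<open>v\<close> the minimizer, a discrete Gronwall argument bounds the
    second moments of the iterates and the weighted sum of the optimality gaps
    \<open>\<delta>\<^sub>k = \<E>(J(U\<^sub>k) - J(u\<^sup>\<sharp>))\<close> (\<open>moments_bounded\<close>). With \<open>v = U\<^sub>i\<close> an earlier iterate, telescoping from
    \<open>D U\<^sub>i U\<^sub>i = 0\<close> bounds \<open>\<Sum>\<^sub>i\<^sub>\<le>\<^sub>k\<^sub>\<le>\<^sub>n \<epsilon>\<^sub>k (\<delta>\<^sub>k - \<delta>\<^sub>i)\<close> by a tail of the error series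
    (\<open>tail_comparison\<close>): on average, the gaps after time \<open>i\<close> hardly exceed the gap at
    time \<open>i\<close>.

  \<^item> \<^emph>\<open>From averages to the last iterate.\<close> Since \<open>\<epsilon>\<close> is nonincreasing, the second estimate compares the
    means of \<open>x\<^sub>k = \<epsilon>\<^sub>k \<delta>\<^sub>k\<close> over the last \<open>m\<close> and the last \<open>m + 1\<close> indices. Chaining these comparisons
    bounds \<open>x\<^sub>n\<close> by the mean of \<open>x\<^sub>1, \<dots>, x\<^sub>n\<close>, which is \<open>O(1/n)\<close>, plus
    \<open>\<Sum>\<^sub>k \<sigma>\<^sub>k / max (n - k) 1\<close> with errors \<open>\<sigma>\<^sub>k = O(k\<^sup>-\<^sup>1\<^sup>-\<^sup>\<eta>)\<close> for some \<open>\<eta> > 0\<close>; this is \<open>O(1/n)\<close> as well. The exponent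
    \<open>\<eta>\<close> is positive exactly because \<open>2\<theta> > 1\<close> and \<open>\<theta> + \<nu> > 1\<close>. Division by \<open>\<epsilon>\<^sub>n = c n\<^sup>-\<^sup>\<theta>\<close> gives
    \<open>\<delta>\<^sub>n = O(n\<^sup>\<theta>\<^sup>-\<^sup>1)\<close> (\<open>last_iterate_rate\<close>).

  The statement on rates close to \<open>n\<^sup>-\<^sup>1\<^sup>/\<^sup>2\<close> follows, because \<open>\<theta> - 1 \<le> - 1/2 + \<delta>\<close> as soon as
  \<open>\<theta> \<le> 1/2 + \<delta>\<close>.
\<close>

section \<open>Subgradients of convex lower semicontinuous functions\<close>

definition sublinear :: "('v::real_vector \<Rightarrow> real) \<Rightarrow> bool" where
  "sublinear p \<longleftrightarrow>
     (\<forall>x y. p (x + y) \<le> p x + p y) \<and> (\<forall>t>0. \<forall>x. p (t *\<^sub>R x) = t * p x)"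

lemma sublinear_add: "sublinear p \<Longrightarrow> p (x + y) \<le> p x + p y"
  by (simp add: sublinear_def)

lemma sublinear_scale: "sublinear p \<Longrightarrow> t > 0 \<Longrightarrow> p (t *\<^sub>R x) = t * p x"
  by (simp add: sublinear_def)

lemma sublinear_zero:
  assumes "sublinear p" shows "p 0 = 0"
  using sublinear_scale[OF assms, of 2 0] by simp

lemma sublinear_minus:
  assumes "sublinear p" shows "- p (- x) \<le> p x"
  using sublinear_add[OF assms, of x "- x"] sublinear_zero[OF assms] by simp

lemma sublinearI:
  assumes add: "\<And>x y. p (x + y) \<le> p x + p y"
    and scale: "\<And>t x. t > 0 \<Longrightarrow> p (t *\<^sub>R x) \<le> t * p x"
  shows "sublinear p"
  unfolding sublinear_def
proof (intro conjI allI impI add)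
  fix t :: real and x assume t: "t > 0"
  have "p x = p (inverse t *\<^sub>R (t *\<^sub>R x))" using t by simp
  also have "\<dots> \<le> inverse t * p (t *\<^sub>R x)" using t by (intro scale) simp
  finally have "t * p x \<le> p (t *\<^sub>R x)" using t by (simp add: field_simps)
  with scale[OF t, of x] show "p (t *\<^sub>R x) = t * p x" by simp
qed

text \<open>For a fixed direction \<open>h\<close>, the functional \<open>y \<mapsto> inf\<^sub>t\<^sub>>\<^sub>0 (q (y + t h) - t q h)\<close> is again sublinear and lies
  below \<open>q\<close>. If \<open>q\<close> is minimal the two agree, which is superadditivity of \<open>q\<close> in the direction \<open>h\<close>.\<close>

lemma minimal_sublinear_is_linear:
  assumes q: "sublinear q" and min: "\<And>r. sublinear r \<Longrightarrow> r \<le> q \<Longrightarrow> r = q"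
  shows "linear q"
proof -
  have super: "q x + q h \<le> q (x + h)" for x h
  proof -
    define r where "r y = (INF t\<in>{0<..}. q (y + t *\<^sub>R h) - t * q h)" for y
    have lower: "- q (- y) \<le> q (y + t *\<^sub>R h) - t * q h" if "t > 0" for y t
      using sublinear_add[OF q, of "y + t *\<^sub>R h" "- y"] sublinear_scale[OF q that, of h] by simp
    have bdd: "bdd_below ((\<lambda>t. q (y + t *\<^sub>R h) - t * q h) ` {0<..})" for y
      by (rule bdd_belowI2[of _ "- q (- y)"]) (use lower in auto)
    have le: "r y \<le> q (y + t *\<^sub>R h) - t * q h" if "t > 0" for y t
      unfolding r_def by (rule cINF_lower[OF bdd]) (use that in auto)
    have ge: "m \<le> r y" if "\<And>t. t > 0 \<Longrightarrow> m \<le> q (y + t *\<^sub>R h) - t * q h" for m y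
      unfolding r_def by (rule cINF_greatest) (use that in auto)
    have sub: "sublinear r"
    proof (rule sublinearI)
      fix y z
      have "r (y + z) - (q (y + t *\<^sub>R h) - t * q h) \<le> r z" if t: "t > 0" for t
      proof (rule ge)
        fix s :: real assume s: "s > 0"
        have "r (y + z) \<le> q ((y + z) + (t + s) *\<^sub>R h) - (t + s) * q h"
          using t s by (intro le) simp
        also have "(y + z) + (t + s) *\<^sub>R h = (y + t *\<^sub>R h) + (z + s *\<^sub>R h)"
          by (simp add: algebra_simps)
        also have "q \<dots> \<le> q (y + t *\<^sub>R h) + q (z + s *\<^sub>R h)" by (rule sublinear_add[OF q])
        finally show "r (y + z) - (q (y + t *\<^sub>R h) - t * q h) \<le> q (z + s *\<^sub>R h) - s * q h"
          by (simp add: algebra_simps)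
      qed
      then have "r (y + z) - r z \<le> r y" by (intro ge) (simp add: algebra_simps)
      then show "r (y + z) \<le> r y + r z" by simp
    next
      fix t :: real and y assume t: "t > 0"
      have "r (t *\<^sub>R y) / t \<le> r y"
      proof (rule ge)
        fix s :: real assume s: "s > 0"
        have "r (t *\<^sub>R y) \<le> q (t *\<^sub>R y + (t * s) *\<^sub>R h) - (t * s) * q h"
          using t s by (intro le) simp
        also have "t *\<^sub>R y + (t * s) *\<^sub>R h = t *\<^sub>R (y + s *\<^sub>R h)" by (simp add: algebra_simps)
        also have "q \<dots> = t * q (y + s *\<^sub>R h)" by (rule sublinear_scale[OF q t])
        finally show "r (t *\<^sub>R y) / t \<le> q (y + s *\<^sub>R h) - s * q h"
          using t by (simp add: field_simps)
      qed
      then show "r (t *\<^sub>R y) \<le> t * r y" using t by (simp add: field_simps)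
    qed
    have "r \<le> q"
    proof (rule le_funI)
      fix y
      have "r y \<le> q (y + t *\<^sub>R h) - t * q h" if "t > 0" for t by (rule le[OF that])
      from this[of 1] sublinear_add[OF q, of y h] show "r y \<le> q y" by simp
    qed
    with min[OF sub] have "r = q" by simp
    with le[of 1 x] show ?thesis by simp
  qed
  have add: "q (x + y) = q x + q y" for x y
    using super[of x y] sublinear_add[OF q, of x y] by simp
  have neg: "q (- x) = - q x" for x
    using add[of x "- x"] sublinear_zero[OF q] by simp
  show ?thesis
  proof (rule linearI[OF add])
    fix t :: real and x
    consider "t > 0" | "t = 0" | "t < 0" by linarith
    then show "q (t *\<^sub>R x) = t *\<^sub>R q x"
    proof cases
      case 3
      then show ?thesis
        using sublinear_scale[OF q, of "- t" x] neg[of "t *\<^sub>R x"] by simp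
    qed (use sublinear_scale[OF q] sublinear_zero[OF q] in auto)
  qed
qed

text \<open>The Hahn-Banach theorem in the form "below every sublinear functional there is a linear one":
  Zorn's lemma gives a minimal sublinear functional below \<open>p\<close>. The pointwise infimum of a chain is
  finite because every sublinear \<open>q \<le> p\<close> satisfies \<open>q x \<ge> - p (- x)\<close>.\<close>

theorem hahn_banach_dominated:
  fixes p :: "'v::real_vector \<Rightarrow> real"
  assumes p: "sublinear p"
  shows "\<exists>q. linear q \<and> q \<le> p"
proof -
  define A where "A = {q. sublinear q \<and> q \<le> p}"
  have "\<exists>m\<in>A. \<forall>a\<in>A. a \<le> m \<longrightarrow> a = m"
  proof (rule predicate_Zorn)
    show "partial_order_on A (relation_of (\<lambda>a u. u \<le> a) A)"
      by (rule partial_order_on_relation_ofI) auto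
    fix C assume "C \<in> Chains (relation_of (\<lambda>a u. u \<le> a) A)"
    then have CA: "a \<in> A" and tot: "a \<le> c \<or> c \<le> a" if "a \<in> C" "c \<in> C" for a c
      using that by (auto simp: Chains_def relation_of_def)
    show "\<exists>u\<in>A. \<forall>a\<in>C. u \<le> a"
    proof (cases "C = {}")
      case True
      then show ?thesis using p by (auto simp: A_def)
    next
      case False
      \<comment> \<open>On a chain the infimum stays subadditive: two members of the chain are replaced by the smaller one.\<close>
      define u where "u x = (INF q\<in>C. q x)" for x
      have lower: "- p (- x) \<le> q x" if "q \<in> C" for q x
        using sublinear_minus[of q x] CA[OF that that] by (auto simp: A_def le_fun_def intro: order_trans[rotated])
      have bdd: "bdd_below ((\<lambda>q. q x) ` C)" for x
        by (rule bdd_belowI2[of _ "- p (- x)"]) (use lower in auto)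
      have le: "u x \<le> q x" if "q \<in> C" for q x
        unfolding u_def by (rule cINF_lower[OF bdd that])
      have ge: "m \<le> u x" if "\<And>q. q \<in> C \<Longrightarrow> m \<le> q x" for m x
        unfolding u_def by (rule cINF_greatest[OF False]) (use that in auto)
      have "sublinear u"
      proof (rule sublinearI)
        fix x y
        have "u (x + y) - q1 x \<le> u y" if 1: "q1 \<in> C" for q1
        proof (rule ge)
          fix q2 assume 2: "q2 \<in> C"
          have "\<exists>q\<in>C. q \<le> q1 \<and> q \<le> q2" using tot[OF 1 2] 1 2 by auto
          then obtain q where q: "q \<in> C" "q \<le> q1" "q \<le> q2" by auto
          have "u (x + y) \<le> q (x + y)" by (rule le[OF q(1)])
          also have "\<dots> \<le> q x + q y"
            using CA[OF q(1) q(1)] by (auto simp: A_def intro: sublinear_add)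
          also have "\<dots> \<le> q1 x + q2 y" using q(2,3) by (intro add_mono) (auto simp: le_fun_def)
          finally show "u (x + y) - q1 x \<le> q2 y" by simp
        qed
        then have "u (x + y) - u y \<le> u x" by (intro ge) (simp add: algebra_simps)
        then show "u (x + y) \<le> u x + u y" by simp
      next
        fix t :: real and x assume t: "t > 0"
        have "u (t *\<^sub>R x) / t \<le> u x"
        proof (rule ge)
          fix q assume q: "q \<in> C"
          have "u (t *\<^sub>R x) \<le> q (t *\<^sub>R x)" by (rule le[OF q])
          also have "\<dots> = t * q x" using CA[OF q q] t by (auto simp: A_def sublinear_scale)
          finally show "u (t *\<^sub>R x) / t \<le> q x" using t by (simp add: field_simps)
        qed
        then show "u (t *\<^sub>R x) \<le> t * u x" using t by (simp add: field_simps)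
      qed
      moreover have "u \<le> p"
      proof -
        obtain q where "q \<in> C" using False by auto
        with le[of q] CA[of q q] show ?thesis by (auto simp: A_def le_fun_def intro: order_trans)
      qed
      ultimately show ?thesis using le by (auto simp: A_def le_fun_def intro!: bexI[of _ u])
    qed
  qed
  then obtain m where m: "sublinear m" "m \<le> p" and min: "\<And>a. a \<in> A \<Longrightarrow> a \<le> m \<Longrightarrow> a = m"
    by (auto simp: A_def)
  have "linear m"
    using m by (intro minimal_sublinear_is_linear min) (auto simp: A_def)
  with m show ?thesis by auto
qed

lemma convex_on_UNIV_le:
  assumes "convex_on UNIV f" "u \<ge> 0" "v \<ge> 0" "u + v = 1"
  shows "f (u *\<^sub>R x + v *\<^sub>R y) \<le> u * f x + v * f y"
  using assms unfolding convex_on_def by blast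

text \<open>The functional is the directional derivative \<open>h \<mapsto> inf\<^sub>t\<^sub>>\<^sub>0 (f (x + t h) - f x) / t\<close>.\<close>

lemma sublinear_directional_derivative:
  fixes f :: "'v::real_vector \<Rightarrow> real"
  assumes f: "convex_on UNIV f"
  shows "\<exists>p. sublinear p \<and> (\<forall>h. p h \<le> f (x + h) - f x)"
proof -
  define p where "p h = (INF t\<in>{0<..}. (f (x + t *\<^sub>R h) - f x) / t)" for h
  have conv: "(s + t) * f z \<le> s * f a + t * f c"
    if "s > 0" "t > 0" "(s + t) *\<^sub>R z = s *\<^sub>R a + t *\<^sub>R c" for s t z a c
  proof -
    have "inverse (s + t) *\<^sub>R (s + t) *\<^sub>R z = inverse (s + t) *\<^sub>R (s *\<^sub>R a + t *\<^sub>R c)"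
      by (simp only: that(3))
    then have "z = (s / (s + t)) *\<^sub>R a + (t / (s + t)) *\<^sub>R c"
      using that(1,2) by (simp add: scaleR_add_right divide_inverse mult.commute)
    moreover have "s / (s + t) + t / (s + t) = 1"
      using that(1,2) by (simp add: add_divide_distrib[symmetric])
    ultimately have "f z \<le> s / (s + t) * f a + t / (s + t) * f c"
      using that(1,2) by (simp only:, intro convex_on_UNIV_le[OF f]) auto
    then have "f z \<le> (s * f a + t * f c) / (s + t)" by (simp add: add_divide_distrib)
    then show ?thesis using that(1,2) by (simp add: pos_le_divide_eq mult.commute)
  qed
  have lower: "f x - f (x - h) \<le> (f (x + t *\<^sub>R h) - f x) / t" if t: "t > 0" for h t
  proof -
    have "(1 + t) * f x \<le> 1 * f (x + t *\<^sub>R h) + t * f (x - h)"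
      using t by (intro conv) (auto simp: algebra_simps)
    then show ?thesis using t by (simp add: field_simps)
  qed
  have bdd: "bdd_below ((\<lambda>t. (f (x + t *\<^sub>R h) - f x) / t) ` {0<..})" for h
    by (rule bdd_belowI2[of _ "f x - f (x - h)"]) (use lower in auto)
  have le: "p h \<le> (f (x + t *\<^sub>R h) - f x) / t" if "t > 0" for h t
    unfolding p_def by (rule cINF_lower[OF bdd]) (use that in auto)
  have ge: "m \<le> p h" if "\<And>t. t > 0 \<Longrightarrow> m \<le> (f (x + t *\<^sub>R h) - f x) / t" for m h
    unfolding p_def by (rule cINF_greatest) (use that in auto)
  have "sublinear p"
  proof (rule sublinearI)
    fix h k
    have "p (h + k) - (f (x + s *\<^sub>R h) - f x) / s \<le> p k" if s: "s > 0" for s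
    proof (rule ge)
      fix t :: real assume t: "t > 0"
      have st: "s + t > 0" using s t by simp
      \<comment> \<open>The step \<open>r\<close> with \<open>1/r = 1/s + 1/t\<close> makes \<open>x + r (h + k)\<close> a convex combination of \<open>x + s h\<close> and \<open>x + t k\<close>.\<close>
      let ?r = "s * t / (s + t)"
      have *: "(t + s) *\<^sub>R (x + ?r *\<^sub>R (h + k)) = t *\<^sub>R (x + s *\<^sub>R h) + s *\<^sub>R (x + t *\<^sub>R k)"
      proof -
        have "(t + s) * ?r = s * t" using st by (simp add: field_simps)
        then show ?thesis
          by (simp only: scaleR_add_right scaleR_scaleR scaleR_add_left mult.commute) simp
      qed
      have "(t + s) * f (x + ?r *\<^sub>R (h + k)) \<le> t * f (x + s *\<^sub>R h) + s * f (x + t *\<^sub>R k)"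
        by (rule conv[OF t s *])
      then have "(f (x + ?r *\<^sub>R (h + k)) - f x) / ?r \<le>
          (f (x + s *\<^sub>R h) - f x) / s + (f (x + t *\<^sub>R k) - f x) / t"
        using s t st by (simp add: divide_simps) (simp add: algebra_simps)
      moreover have "p (h + k) \<le> (f (x + ?r *\<^sub>R (h + k)) - f x) / ?r"
        using s t by (intro le) simp
      ultimately show "p (h + k) - (f (x + s *\<^sub>R h) - f x) / s \<le> (f (x + t *\<^sub>R k) - f x) / t"
        by linarith
    qed
    then have "p (h + k) - p k \<le> p h" by (intro ge) (simp add: algebra_simps)
    then show "p (h + k) \<le> p h + p k" by simp
  next
    fix t :: real and h assume t: "t > 0"
    have "p (t *\<^sub>R h) / t \<le> p h"
    proof (rule ge)
      fix s :: real assume s: "s > 0"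
      have "p (t *\<^sub>R h) \<le> (f (x + (s / t) *\<^sub>R (t *\<^sub>R h)) - f x) / (s / t)"
        using t s by (intro le) simp
      then show "p (t *\<^sub>R h) / t \<le> (f (x + s *\<^sub>R h) - f x) / s"
        using t s by (simp add: field_simps)
    qed
    then show "p (t *\<^sub>R h) \<le> t * p h" using t by (simp add: field_simps)
  qed
  moreover have "p h \<le> f (x + h) - f x" for h using le[of 1 h] by simp
  ultimately show ?thesis by auto
qed

text \<open>The closed sublevel sets \<open>{f \<le> n}\<close> cover the space, so by Baire's theorem one of them contains a
  ball around some point \<open>z\<close>. The point \<open>x\<close> is the midpoint of \<open>z\<close> and \<open>2 x - z\<close>, and convexity carries the
  bound from \<open>z\<close> to \<open>x\<close>.\<close>

lemma convex_lsc_bounded_above_near: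
  fixes f :: "'u::banach \<Rightarrow> real"
  assumes f: "convex_on UNIV f" "lsc f"
  shows "\<exists>r>0. \<exists>M. \<forall>h. norm h < r \<longrightarrow> f (x + h) \<le> M"
proof -
  define S where "S n = {u. f u \<le> real n}" for n :: nat
  have closed: "closed (S n)" for n
  proof -
    have "- S n = {u. real n < f u}" by (auto simp: S_def)
    then show ?thesis using f(2) by (simp add: closed_def lsc_def)
  qed
  have "\<exists>n. interior (S n) \<noteq> {}"
  proof (rule ccontr)
    assume "\<not> ?thesis"
    then have "Met_TC.mtopology interior_of \<Union>(range S) = {}"
      using closed by (intro Met_TC.metric_Baire_category_alt)
        (auto simp: complete_UNIV)
    moreover have "\<Union>(range S) = UNIV"
      using real_arch_simple by (auto simp: S_def)
    ultimately show False by simp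
  qed
  then obtain n z where "z \<in> interior (S n)" by auto
  then obtain r where r: "r > 0" "ball z r \<subseteq> S n" by (auto simp: mem_interior)
  have "f (x + h) \<le> f (2 *\<^sub>R x - z) / 2 + real n / 2" if h: "norm h < r / 2" for h
  proof -
    have "z + 2 *\<^sub>R h \<in> ball z r" using h by (simp add: dist_norm)
    then have n: "f (z + 2 *\<^sub>R h) \<le> real n" using r by (auto simp: S_def)
    have "x + h = (1 / 2) *\<^sub>R (2 *\<^sub>R x - z) + (1 / 2) *\<^sub>R (z + 2 *\<^sub>R h)"
      by (simp add: algebra_simps)
    moreover have "f ((1 / 2) *\<^sub>R (2 *\<^sub>R x - z) + (1 / 2) *\<^sub>R (z + 2 *\<^sub>R h))
        \<le> 1 / 2 * f (2 *\<^sub>R x - z) + 1 / 2 * f (z + 2 *\<^sub>R h)"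
      by (rule convex_on_UNIV_le[OF f(1)]) auto
    ultimately have "f (x + h) \<le> 1 / 2 * f (2 *\<^sub>R x - z) + 1 / 2 * f (z + 2 *\<^sub>R h)" by simp
    with n show ?thesis by simp
  qed
  with r show ?thesis by (meson half_gt_zero)
qed

text \<open>A linear functional below the directional derivative is a subgradient as soon as it is continuous,
  and the local upper bound on \<open>f\<close> provides continuity.\<close>

theorem convex_lsc_subdifferentiable:
  fixes f :: "'u::banach \<Rightarrow> real"
  assumes f: "convex_on UNIV f" "lsc f"
  shows "subdifferential f x \<noteq> {}"
proof -
  obtain r M where r: "r > 0" and M: "\<And>h. norm h < r \<Longrightarrow> f (x + h) \<le> M"
    using convex_lsc_bounded_above_near[OF f] by metis
  obtain p where p: "sublinear p" "\<And>h. p h \<le> f (x + h) - f x"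
    using sublinear_directional_derivative[OF f(1)] by metis
  obtain q where q: "linear q" "q \<le> p" using hahn_banach_dominated[OF p(1)] by auto
  have qf: "q h \<le> f (x + h) - f x" for h using q(2) p(2)[of h] by (auto simp: le_fun_def intro: order_trans)
  have upper: "q h \<le> norm h * (2 * (M - f x) / r)" for h
  proof (cases "h = 0")
    case True
    then show ?thesis using linear_0[OF q(1)] by simp
  next
    case False
    let ?t = "r / (2 * norm h)"
    have "norm (?t *\<^sub>R h) < r" using False r by simp
    then have "q (?t *\<^sub>R h) \<le> M - f x" using qf[of "?t *\<^sub>R h"] M[of "?t *\<^sub>R h"] by linarith
    then have "?t * q h \<le> M - f x" using linear_scale[OF q(1)] by simp
    then show ?thesis using False r by (simp add: field_simps)
  qed
  have "bounded_linear q"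
  proof (rule bounded_linear_intro[where K = "2 * (M - f x) / r"])
    fix h
    show "norm (q h) \<le> norm h * (2 * (M - f x) / r)"
      using upper[of h] upper[of "- h"] linear_neg[OF q(1), of h] by simp
  qed (use linear_add[OF q(1)] linear_scale[OF q(1)] in auto)
  then have "Blinfun q \<in> subdifferential f x"
    using qf[of "_ - x"] by (simp add: subdifferential_def bounded_linear_Blinfun_apply algebra_simps)
  then show ?thesis by auto
qed


section \<open>Joint measurability of lower semicontinuous functions\<close>

text \<open>The space \<open>'w\<close> may have no countable base, so the Borel sets of the product need not be generated
  by rectangles in general. One second countable factor is enough: every open set of the product is the
  union, over the base sets \<open>c\<close> of that factor, of \<open>c\<close> times the largest open \<open>V\<close> for which \<open>c \<times> V\<close> still fits
  in.\<close>

lemma lsc_measurable_pair: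
  fixes f :: "'u::second_countable_topology \<times> 'w::topological_space \<Rightarrow> real"
  assumes "lsc f"
  shows "f \<in> borel_measurable (borel \<Otimes>\<^sub>M borel)"
  unfolding borel_measurable_iff_greater
proof
  fix a
  let ?S = "{z. a < f z}"
  have opn: "open ?S" using assms by (simp add: lsc_def)
  obtain B :: "'u set set" where B: "countable B" "topological_basis B"
    using ex_countable_basis by auto
  define V where "V c = \<Union>{V. open V \<and> c \<times> V \<subseteq> ?S}" for c
  have "?S = (\<Union>c\<in>B. c \<times> V c)"
  proof (intro set_eqI iffI)
    fix z assume "z \<in> ?S"
    then obtain A W where AW: "open A" "open W" "z \<in> A \<times> W" "A \<times> W \<subseteq> ?S"
      by (rule open_prod_elim[OF opn])
    obtain c where c: "c \<in> B" "fst z \<in> c" "c \<subseteq> A"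
      using topological_basisE[OF B(2) AW(1), of "fst z"] AW(3) by (auto simp: mem_Times_iff)
    have "W \<subseteq> V c" using AW c by (auto simp: V_def)
    then show "z \<in> (\<Union>c\<in>B. c \<times> V c)" using c AW(3) by (auto simp: mem_Times_iff)
  qed (auto simp: V_def)
  also have "\<dots> \<in> sets (borel \<Otimes>\<^sub>M borel)"
  proof (rule sets.countable_UN''[OF B(1)])
    fix c assume "c \<in> B"
    then have "open c" using B(2) by (rule topological_basis_open[rotated])
    moreover have "open (V c)" by (auto simp: V_def)
    ultimately show "c \<times> V c \<in> sets (borel \<Otimes>\<^sub>M borel)" by auto
  qed
  finally show "{w \<in> space (borel \<Otimes>\<^sub>M borel). a < f w} \<in> sets (borel \<Otimes>\<^sub>M borel)"
    by (simp add: space_pair_measure)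
qed


section \<open>Strongly convex kernels and one auxiliary minimization\<close>

definition bregman ::
    "('u::real_normed_vector \<Rightarrow> real) \<Rightarrow> ('u \<Rightarrow> 'u \<Rightarrow>\<^sub>L real) \<Rightarrow> 'u \<Rightarrow> 'u \<Rightarrow> real" where
  "bregman K gradK v u = K v - K u - gradK u (v - u)"

locale strongly_convex_kernel =
  fixes K :: "'u::real_normed_vector \<Rightarrow> real" and gradK :: "'u \<Rightarrow> 'u \<Rightarrow>\<^sub>L real" and b LK :: real
  assumes b_pos: "b > 0" and LK_pos: "LK > 0"
    and strongly_convex: "K v \<ge> K u + gradK u (v - u) + b / 2 * (norm (u - v))\<^sup>2"
    and lipschitz: "norm (gradK v - gradK u) \<le> LK * norm (v - u)"
begin

abbreviation D :: "'u \<Rightarrow> 'u \<Rightarrow> real" where "D \<equiv> bregman K gradK"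

lemma K_above_tangent: "K u + gradK u (v - u) \<le> K v"
proof -
  have "0 \<le> b / 2 * (norm (u - v))\<^sup>2" using b_pos by simp
  with strongly_convex[of u v] show ?thesis by linarith
qed

lemma gradK_monotone_upper: "gradK v h - gradK u h \<le> LK * norm (v - u) * norm h"
proof -
  have "gradK v h - gradK u h = (gradK v - gradK u) h" by (simp add: blinfun.diff_left)
  also have "\<dots> \<le> norm (gradK v - gradK u) * norm h"
    using norm_blinfun[of "gradK v - gradK u" h] by simp
  also have "\<dots> \<le> LK * norm (v - u) * norm h"
    by (intro mult_right_mono lipschitz) simp
  finally show ?thesis .
qed

lemma bregman_lower: "b / 2 * (norm (v - u))\<^sup>2 \<le> D v u"
  using strongly_convex[of u v] by (simp add: bregman_def norm_minus_commute)

lemma bregman_nonneg: "0 \<le> D v u"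
  using bregman_lower[of v u] b_pos by (meson order_trans zero_le_power2 mult_nonneg_nonneg divide_nonneg_pos less_imp_le zero_less_numeral)

lemma bregman_upper: "D v u \<le> LK * (norm (v - u))\<^sup>2"
proof -
  have "D v u \<le> gradK v (v - u) - gradK u (v - u)"
    using K_above_tangent[of v u] by (simp add: bregman_def blinfun.diff_right)
  also have "\<dots> \<le> LK * (norm (v - u))\<^sup>2"
    using gradK_monotone_upper[of v "v - u" u] by (simp add: power2_eq_square mult.assoc)
  finally show ?thesis .
qed

lemma continuous_gradK: "continuous_on UNIV gradK"
proof (rule lipschitz_on_continuous_on)
  show "LK-lipschitz_on UNIV gradK"
    using lipschitz LK_pos by (intro lipschitz_onI) (auto simp: dist_norm)
qed

lemma continuous_K: "continuous_on UNIV K"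
  unfolding continuous_on_def
proof
  fix u
  have "((\<lambda>v. K v - K u) \<longlongrightarrow> 0) (at u)"
  proof (rule tendsto_sandwich)
    show "\<forall>\<^sub>F v in at u. - (norm (gradK u) * norm (v - u)) \<le> K v - K u"
    proof (intro always_eventually allI)
      fix v
      have "- (norm (gradK u) * norm (v - u)) \<le> gradK u (v - u)"
        using norm_blinfun[of "gradK u" "v - u"] by (simp add: abs_le_iff)
      with K_above_tangent[of u v] show "- (norm (gradK u) * norm (v - u)) \<le> K v - K u" by linarith
    qed
    show "\<forall>\<^sub>F v in at u. K v - K u \<le> norm (gradK v) * norm (v - u)"
    proof (intro always_eventually allI)
      fix v
      have "gradK v (u - v) = - gradK v (v - u)" by (simp add: blinfun.diff_right)
      moreover have "gradK v (v - u) \<le> norm (gradK v) * norm (v - u)"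
        using norm_blinfun[of "gradK v" "v - u"] by (simp add: abs_le_iff)
      ultimately show "K v - K u \<le> norm (gradK v) * norm (v - u)"
        using K_above_tangent[of v u] by linarith
    qed
    have *: "((\<lambda>v. norm (v - u)) \<longlongrightarrow> 0) (at u)"
      by (auto intro!: tendsto_eq_intros)
    show "((\<lambda>v. - (norm (gradK u) * norm (v - u))) \<longlongrightarrow> 0) (at u)"
      using tendsto_minus[OF tendsto_mult[OF tendsto_const[of "norm (gradK u)"] *]] by simp
    have "(gradK \<longlongrightarrow> gradK u) (at u)"
      using continuous_gradK by (simp add: continuous_on_def)
    from tendsto_mult[OF tendsto_norm[OF this] *]
    show "((\<lambda>v. norm (gradK v) * norm (v - u)) \<longlongrightarrow> 0) (at u)" by simp
  qed
  then show "(K \<longlongrightarrow> K u) (at u within UNIV)" by (rule LIM_zero_cancel)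
qed

lemma continuous_bregman: "continuous_on UNIV (\<lambda>z. D (fst z) (snd z))"
  unfolding bregman_def
  by (intro continuous_intros bounded_bilinear.continuous_on[OF bounded_bilinear_blinfun_apply]
      continuous_on_compose2[OF continuous_K] continuous_on_compose2[OF continuous_gradK]) auto

text \<open>The first-order condition at the minimizer \<open>y\<close>, obtained by comparing \<open>y\<close> with the points
  \<open>y + t (v - y)\<close>, dividing by \<open>t\<close> and letting \<open>t \<rightarrow> 0\<close>. The gradient is evaluated at the displaced point
  and moved back to \<open>y\<close> by its Lipschitz continuity.\<close>

lemma minimizer_variational_inequality:
  fixes l :: "'u \<Rightarrow>\<^sub>L real"
  assumes S: "convex S" and g: "convex_on UNIV g"
    and y: "is_arg_min (\<lambda>v. K v + l v + g v) (\<lambda>v. v \<in> S) y" and v: "v \<in> S"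
  shows "0 \<le> gradK y (v - y) + l (v - y) + g v - g y"
proof (rule tendsto_lowerbound)
  let ?A = "gradK y (v - y) + l (v - y) + g v - g y"
  show "\<forall>\<^sub>F t in at_right 0. 0 \<le> ?A + t * (LK * norm (v - y) * norm (v - y))"
    using eventually_at_right_real[of 0 1, OF zero_less_one]
  proof eventually_elim
    fix t :: real assume "t \<in> {0<..<1}"
    then have t: "0 < t" "t < 1" by auto
    let ?z = "y + t *\<^sub>R (v - y)"
    have yS: "y \<in> S" and le: "\<And>z. z \<in> S \<Longrightarrow> K y + l y + g y \<le> K z + l z + g z"
      using y by (auto simp: is_arg_min_linorder)
    have z: "?z = (1 - t) *\<^sub>R y + t *\<^sub>R v" by (simp add: algebra_simps)
    have "?z \<in> S" unfolding z using convexD[OF S yS v, of "1 - t" t] t by simp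
    have 1: "K y + l y + g y \<le> K ?z + l ?z + g ?z" by (rule le) fact
    have 2: "g ?z \<le> (1 - t) * g y + t * g v"
      unfolding z using t by (intro convex_on_UNIV_le[OF g]) auto
    have 3: "l ?z = l y + t * l (v - y)" by (simp add: blinfun.add_right blinfun.scaleR_right)
    have "K ?z + gradK ?z (y - ?z) \<le> K y" by (rule K_above_tangent)
    moreover have "gradK ?z (y - ?z) = - t * gradK ?z (v - y)"
      by (simp add: blinfun.minus_right blinfun.scaleR_right)
    ultimately have 4: "K ?z \<le> K y + t * gradK ?z (v - y)" by simp
    have "gradK ?z (v - y) - gradK y (v - y) \<le> LK * norm (?z - y) * norm (v - y)"
      by (rule gradK_monotone_upper)
    moreover have "norm (?z - y) = t * norm (v - y)" using t by simp
    ultimately have 5: "gradK ?z (v - y) \<le> gradK y (v - y) + t * (LK * norm (v - y) * norm (v - y))"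
      using t by (simp add: algebra_simps)
    have "t * gradK ?z (v - y) \<le> t * (gradK y (v - y) + t * (LK * norm (v - y) * norm (v - y)))"
      using 5 t by (intro mult_left_mono) auto
    with 1 2 3 4 have "0 \<le> t * (gradK y (v - y) + t * (LK * norm (v - y) * norm (v - y)))
        + t * l (v - y) + t * g v - t * g y"
      by (simp add: algebra_simps)
    also have "\<dots> = t * (?A + t * (LK * norm (v - y) * norm (v - y)))"
      by (simp add: algebra_simps)
    finally show "0 \<le> ?A + t * (LK * norm (v - y) * norm (v - y))"
      using t by (simp add: zero_le_mult_iff)
  qed
  show "((\<lambda>t. ?A + t * (LK * norm (v - y) * norm (v - y))) \<longlongrightarrow> ?A) (at_right 0)"
    by (auto intro!: tendsto_eq_intros)
qed simp

text \<open>The three-point identity for \<open>D\<close> turns the variational inequality into a bound on \<open>D v y\<close> with the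
  negative term \<open>- D y u \<le> - b/2 (norm (u - y))\<^sup>2\<close>. This term absorbs, by Young's inequality, everything
  that is linear in \<open>norm (u - y)\<close>. Evaluating \<open>j\<^sup>\<Sigma>\<close> at \<open>u\<close> instead of at the implicit point \<open>y\<close> costs one such
  term, with the norm of a subgradient \<open>s\<close> at \<open>u\<close> as coefficient.\<close>

lemma auxiliary_step:
  fixes G R s :: "'u \<Rightarrow>\<^sub>L real"
  assumes S: "convex S" and jS: "convex_on UNIV (\<lambda>u. jS u w)" and e: "e > 0"
    and y: "is_arg_min (auxiliary_objective jS K gradK e (G + R) u w) (\<lambda>v. v \<in> S) y"
    and v: "v \<in> S"
    and G: "G \<in> subdifferential (\<lambda>u. jC u w) u" and s: "s \<in> subdifferential (\<lambda>u. jS u w) u"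
    and H: "norm G + norm s \<le> H"
  shows "D v y \<le> D v u + e * ((jC v w + jS v w) - (jC u w + jS u w))
           + e * norm R * norm (v - u) + (e * (H + norm R))\<^sup>2 / (2 * b)"
proof -
  let ?d = "norm (u - y)"
  have op: "blinfun_apply f h \<le> norm f * norm h" for f :: "'u \<Rightarrow>\<^sub>L real" and h
    using norm_blinfun[of f h] by simp
  have "0 \<le> gradK y (v - y) + (e *\<^sub>R (G + R) - gradK u) (v - y) + e * jS v w - e * jS y w"
    using y e jS unfolding auxiliary_objective_def
    by (intro minimizer_variational_inequality[OF S _ _ v] convex_on_cmul) auto
  moreover have "D v u - D v y - D y u = gradK y (v - y) - gradK u (v - y)"
    by (simp add: bregman_def blinfun.diff_right)
  ultimately have 1: "D v y \<le> D v u - D y u + e * ((G (v - y) + R (v - y)) + (jS v w - jS y w))"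
    by (simp add: blinfun.diff_left blinfun.scaleR_left blinfun.add_left algebra_simps)
  have "G (v - y) = G (v - u) + G (u - y)" by (simp add: blinfun.diff_right)
  moreover have "jC u w + G (v - u) \<le> jC v w" using G by (auto simp: subdifferential_def)
  ultimately have 2: "G (v - y) \<le> jC v w - jC u w + norm G * ?d"
    using op[of G "u - y"] by linarith
  have "jS u w + s (y - u) \<le> jS y w" using s by (auto simp: subdifferential_def)
  moreover have "s (y - u) = - s (u - y)" by (simp add: blinfun.diff_right)
  ultimately have 3: "jS v w - jS y w \<le> jS v w - jS u w + norm s * ?d"
    using op[of s "u - y"] by linarith
  have "R (v - y) = R (v - u) + R (u - y)" by (simp add: blinfun.diff_right)
  then have 4: "R (v - y) \<le> norm R * norm (v - u) + norm R * ?d"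
    using op[of R "v - u"] op[of R "u - y"] by linarith
  have "(norm G + norm s) * ?d \<le> H * ?d" by (intro mult_right_mono H) simp
  with 2 3 4 have "(G (v - y) + R (v - y)) + (jS v w - jS y w) \<le>
      ((jC v w + jS v w) - (jC u w + jS u w)) + norm R * norm (v - u) + (H + norm R) * ?d"
    by (simp add: distrib_right)
  from mult_left_mono[OF this, of e]
  have 5: "e * ((G (v - y) + R (v - y)) + (jS v w - jS y w)) \<le>
      e * ((jC v w + jS v w) - (jC u w + jS u w)) + e * norm R * norm (v - u) + e * (H + norm R) * ?d"
    using e by (simp add: algebra_simps)
  have 6: "b / 2 * ?d\<^sup>2 \<le> D y u" using bregman_lower[of y u] by (simp add: norm_minus_commute)
  have "0 \<le> b / 2 * (?d - e * (H + norm R) / b)\<^sup>2" using b_pos by simp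
  also have "\<dots> = b / 2 * ?d\<^sup>2 - e * (H + norm R) * ?d + (e * (H + norm R))\<^sup>2 / (2 * b)"
    using b_pos by (simp add: power2_eq_square field_simps)
  finally have 7: "e * (H + norm R) * ?d \<le> b / 2 * ?d\<^sup>2 + (e * (H + norm R))\<^sup>2 / (2 * b)" by simp
  from 1 5 6 7 show ?thesis by linarith
qed

end


section \<open>Real sequences: from averages to the last term\<close>

text \<open>A discrete Gronwall lemma. First \<open>1 + a\<^sub>k\<close> grows at most by the factor \<open>exp (C \<sigma>\<^sub>k)\<close>, which bounds \<open>a\<close>. With
  \<open>a\<close> bounded, the perturbations are summable and telescoping bounds the sum of \<open>x\<close>.\<close>

lemma perturbed_descent_bounded:
  fixes a x \<sigma> :: "nat \<Rightarrow> real"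
  assumes a: "\<And>k. 0 \<le> a k" and x: "\<And>k. 0 \<le> x k" and \<sigma>: "\<And>k. 0 \<le> \<sigma> k" "summable \<sigma>"
    and C: "0 \<le> C"
    and step: "\<And>k. a (Suc k) \<le> a k - x k + C * \<sigma> k * (1 + a k)"
  shows "\<exists>M. \<forall>k. a k \<le> M \<and> (\<Sum>i<k. x i) \<le> M"
proof -
  define S where "S = suminf \<sigma>"
  have S: "(\<Sum>i<k. \<sigma> i) \<le> S" for k
    unfolding S_def using \<sigma> by (intro sum_le_suminf) auto
  have S0: "0 \<le> S" using S[of 0] by simp
  define M where "M = (1 + a 0) * exp (C * S)"
  have grow: "1 + a k \<le> (1 + a 0) * exp (C * (\<Sum>i<k. \<sigma> i))" for k
  proof (induction k)
    case (Suc k)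
    have "1 + a (Suc k) \<le> (1 + C * \<sigma> k) * (1 + a k)"
      using step[of k] x[of k] by (simp add: algebra_simps)
    also have "\<dots> \<le> exp (C * \<sigma> k) * ((1 + a 0) * exp (C * (\<Sum>i<k. \<sigma> i)))"
      using Suc a[of k] C \<sigma>(1)[of k] by (intro mult_mono exp_ge_add_one_self) auto
    also have "\<dots> = (1 + a 0) * exp (C * (\<Sum>i<Suc k. \<sigma> i))"
      by (simp add: distrib_left exp_add)
    finally show ?case .
  qed simp
  have aM: "1 + a k \<le> M" for k
  proof -
    have "(1 + a 0) * exp (C * (\<Sum>i<k. \<sigma> i)) \<le> M"
      unfolding M_def using S[of k] C a[of 0] by (intro mult_left_mono) (auto intro: mult_left_mono)
    with grow[of k] show ?thesis by simp
  qed
  have tele: "a k + (\<Sum>i<k. x i) \<le> a 0 + C * M * (\<Sum>i<k. \<sigma> i)" for k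
  proof (induction k)
    case (Suc k)
    have "C * \<sigma> k * (1 + a k) \<le> C * \<sigma> k * M"
      using aM[of k] C \<sigma>(1)[of k] by (intro mult_left_mono) auto
    with Suc step[of k] show ?case by (simp add: algebra_simps)
  qed simp
  have M0: "M \<ge> 0" using aM[of 0] a[of 0] by simp
  show ?thesis
  proof (intro exI[of _ "a 0 + C * M * S + M"] allI conjI)
    fix k
    have CMS: "0 \<le> C * M * S" using C M0 S0 by simp
    show "a k \<le> a 0 + C * M * S + M" using aM[of k] a[of 0] CMS by linarith
    have "C * M * (\<Sum>i<k. \<sigma> i) \<le> C * M * S" using C M0 S[of k] by (intro mult_left_mono) auto
    with tele[of k] a[of k] M0 show "(\<Sum>i<k. x i) \<le> a 0 + C * M * S + M" by linarith
  qed
qed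

lemma weighted_mean_step:
  fixes m X y Y :: real
  assumes m: "m > 0" and le: "X \<le> m * y + Y"
  shows "X / m \<le> (y + X) / (m + 1) + Y * (1 / m - 1 / (m + 1))"
proof -
  have "(y + X) / (m + 1) + Y * (1 / m - 1 / (m + 1)) - X / m = (m * y + Y - X) / (m * (m + 1))"
    using m by (simp add: divide_simps) (simp add: algebra_simps)
  also have "\<dots> \<ge> 0" using m le by simp
  finally show ?thesis by simp
qed

lemma powr_minus_one_plus:
  fixes a \<eta> :: real
  assumes "a > 0"
  shows "a powr (- (1 + \<eta>)) = a powr (- \<eta>) / a"
proof -
  have "- (1 + \<eta>) = - \<eta> - 1" by simp
  then show ?thesis using assms by (simp only: powr_diff) simp
qed

text \<open>The claim holds for the mean over the last \<open>m\<close> terms in place of all \<open>n\<close>, by induction on \<open>m\<close>. Passing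
  from \<open>m\<close> to \<open>m + 1\<close> costs \<open>1/m - 1/(m + 1)\<close> times a tail of \<open>\<sigma>\<close>, and these costs telescope: the total weight of
  \<open>\<sigma>\<^sub>k\<close> runs over \<open>m\<close> from \<open>max (n - k) 1\<close> on.\<close>

lemma last_term_le_average:
  fixes x \<sigma> :: "nat \<Rightarrow> real"
  assumes tail: "\<And>i. 1 \<le> i \<Longrightarrow> i \<le> n \<Longrightarrow>
      (\<Sum>k=i..n. x k) \<le> real (n - i + 1) * x i + (\<Sum>k=i..n. \<sigma> k)"
    and n: "n \<ge> 1"
  shows "x n \<le> (\<Sum>k=1..n. x k) / real n + (\<Sum>k=1..n. \<sigma> k * (1 / real (max (n - k) 1) - 1 / real n))"
proof -
  have "x n \<le> (\<Sum>k=n+1-m..n. x k) / real m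
      + (\<Sum>k=n+1-m..n. \<sigma> k * (1 / real (max (n - k) 1) - 1 / real m))"
    if "1 \<le> m" "m \<le> n" for m
    using that
  proof (induction m rule: dec_induct)
    case base
    then show ?case using n by simp
  next
    case (step m)
    define i where "i = n - m"
    have i: "1 \<le> i" "i \<le> n" "n + 1 - Suc m = i" "n + 1 - m = Suc i" "n - i = m" "n - i + 1 = Suc m"
      using step by (auto simp: i_def)
    have m: "real m > 0" using step by simp
    have split: "sum f {i..n} = f i + sum f {Suc i..n}" for f :: "nat \<Rightarrow> real"
      using i by (intro sum.atLeast_Suc_atMost)
    define X where "X = (\<Sum>k=Suc i..n. x k)"
    define Y where "Y = (\<Sum>k=i..n. \<sigma> k)"
    have "x i + X \<le> real (Suc m) * x i + Y"
      using tail[OF i(1,2)] split[of x] i(6) by (simp add: X_def Y_def)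
    then have "X \<le> real m * x i + Y" by (simp add: algebra_simps)
    then have A: "X / m \<le> (x i + X) / Suc m + Y * (1 / m - 1 / Suc m)"
      using weighted_mean_step[of "real m" X "x i" Y] m by (simp add: add.commute)
    have "(\<Sum>k=i..n. \<sigma> k * (1 / real (max (n - k) 1) - 1 / real (Suc m)))
        = (\<Sum>k=i..n. \<sigma> k * (1 / real (max (n - k) 1) - 1 / real m) + \<sigma> k * (1 / m - 1 / Suc m))"
      by (intro sum.cong refl) (simp add: algebra_simps)
    also have "\<dots> = (\<Sum>k=i..n. \<sigma> k * (1 / real (max (n - k) 1) - 1 / real m)) + Y * (1 / m - 1 / Suc m)"
      by (simp add: sum.distrib Y_def sum_distrib_right)
    also have "(\<Sum>k=i..n. \<sigma> k * (1 / real (max (n - k) 1) - 1 / real m))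
        = (\<Sum>k=Suc i..n. \<sigma> k * (1 / real (max (n - k) 1) - 1 / real m))"
      unfolding split using step i(5) by (simp add: max_def)
    finally have B: "(\<Sum>k=i..n. \<sigma> k * (1 / real (max (n - k) 1) - 1 / real (Suc m))) =
      (\<Sum>k=Suc i..n. \<sigma> k * (1 / real (max (n - k) 1) - 1 / real m)) + Y * (1 / m - 1 / Suc m)" .
    have "x n \<le> X / m + (\<Sum>k=Suc i..n. \<sigma> k * (1 / real (max (n - k) 1) - 1 / real m))"
      using step i(4) by (simp add: X_def)
    with A B show ?case unfolding i(3) split[of x] by (simp add: X_def)
  qed
  from this[of n] n show ?thesis by simp
qed

text \<open>Partial fractions give \<open>1 / (k m) = (1/k + 1/m) / (k + m)\<close>. The mixed term \<open>k\<^sup>-\<^sup>\<eta> / m\<close> is at most the power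
  \<open>-1-\<eta>\<close> of the smaller of the two numbers.\<close>

lemma powr_convolution_bound:
  fixes k m :: nat and \<eta> :: real
  assumes "k \<ge> 1" "m \<ge> 1" "\<eta> > 0"
  shows "real k powr (- (1 + \<eta>)) / m \<le>
    (2 * real k powr (- (1 + \<eta>)) + real m powr (- (1 + \<eta>))) / (k + m)"
proof -
  let ?a = "real k" and ?c = "real m"
  have pos: "?a > 0" "?c > 0" using assms by auto
  have key: "?a powr (- \<eta>) / ?c \<le> ?a powr (- (1 + \<eta>)) + ?c powr (- (1 + \<eta>))"
  proof (cases "?a \<le> ?c")
    case True
    have "?a powr (- \<eta>) / ?c \<le> ?a powr (- \<eta>) / ?a" using True pos by (intro divide_left_mono) auto
    also have "\<dots> = ?a powr (- (1 + \<eta>))" using pos by (simp only: powr_minus_one_plus)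
    finally show ?thesis by (simp add: add_increasing2)
  next
    case False
    have "?a powr (- \<eta>) / ?c \<le> ?c powr (- \<eta>) / ?c"
      using False pos assms by (intro divide_right_mono powr_mono2') auto
    also have "\<dots> = ?c powr (- (1 + \<eta>))" using pos by (simp only: powr_minus_one_plus)
    finally show ?thesis by (simp add: add_increasing)
  qed
  have "p / ?c = (p + ?a * p / ?c) / (?a + ?c)" for p
    using pos by (simp add: divide_simps) (simp add: algebra_simps)
  then have "?a powr (- (1 + \<eta>)) / ?c = (?a powr (- (1 + \<eta>)) + ?a * ?a powr (- (1 + \<eta>)) / ?c) / (?a + ?c)"
    .
  also have "?a * ?a powr (- (1 + \<eta>)) = ?a powr (- \<eta>)"
    using pos by (simp only: powr_minus_one_plus) simp
  also have "(?a powr (- (1 + \<eta>)) + ?a powr (- \<eta>) / ?c) / (?a + ?c) \<le>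
      (?a powr (- (1 + \<eta>)) + (?a powr (- (1 + \<eta>)) + ?c powr (- (1 + \<eta>)))) / (?a + ?c)"
    using pos key by (intro divide_right_mono add_mono) auto
  finally show ?thesis by (simp add: algebra_simps)
qed

text \<open>Summing the previous bound over \<open>k + m = n\<close> leaves three copies of a convergent series, divided by \<open>n\<close>.
  The index \<open>k = n\<close>, where \<open>m\<close> would vanish, contributes at most \<open>1/n\<close>.\<close>

lemma powr_convolution_sum_bound:
  fixes \<eta> :: real
  assumes "\<eta> > 0"
  shows "\<exists>Z\<ge>0. \<forall>n\<ge>1. (\<Sum>k=1..n. real k powr (- (1 + \<eta>)) / real (max (n - k) 1)) \<le> Z / real n"
proof -
  define p :: "nat \<Rightarrow> real" where "p = (\<lambda>k. real k powr (- (1 + \<eta>)))"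
  have "summable p" using assms by (simp add: p_def summable_real_powr_iff)
  then have S: "sum p A \<le> suminf p" if "finite A" for A
    using that by (intro sum_le_suminf) (auto simp: p_def)
  have p0: "p k \<ge> 0" for k by (simp add: p_def)
  have S0: "0 \<le> suminf p" using S[of "{}"] by simp
  show ?thesis
  proof (intro exI[of _ "3 * suminf p + 1"] conjI allI impI)
    fix n :: nat assume n: "n \<ge> 1"
    have "(\<Sum>k=1..n. p k / real (max (n - k) 1)) = (\<Sum>k\<in>{1..<n}. p k / real (max (n - k) 1)) + p n"
    proof -
      have "{1..n} = insert n {1..<n}" using n by auto
      then show ?thesis by simp
    qed
    also have "(\<Sum>k\<in>{1..<n}. p k / real (max (n - k) 1)) \<le> (\<Sum>k\<in>{1..<n}. (2 * p k + p (n - k)) / n)"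
    proof (rule sum_mono)
      fix k assume k: "k \<in> {1..<n}"
      then have "1 \<le> n - k" by auto
      then have mx: "max (n - k) 1 = n - k" by simp
      from k \<open>1 \<le> n - k\<close> have "p k / real (n - k) \<le> (2 * p k + p (n - k)) / real (k + (n - k))"
        unfolding p_def using powr_convolution_bound[of k "n - k" \<eta>] assms by simp
      with k show "p k / real (max (n - k) 1) \<le> (2 * p k + p (n - k)) / n" unfolding mx by simp
    qed
    also have "\<dots> = (2 * (\<Sum>k\<in>{1..<n}. p k) + (\<Sum>k\<in>{1..<n}. p (n - k))) / n"
      by (simp add: sum_divide_distrib sum.distrib sum_distrib_left add_divide_distrib)
    also have "(\<Sum>k\<in>{1..<n}. p (n - k)) = (\<Sum>k\<in>{1..<n}. p k)"
      by (rule sum.reindex_bij_witness[of _ "\<lambda>k. n - k" "\<lambda>k. n - k"]) auto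
    also have "(2 * (\<Sum>k\<in>{1..<n}. p k) + (\<Sum>k\<in>{1..<n}. p k)) / n \<le> 3 * suminf p / n"
      using S[of "{1..<n}"] by (intro divide_right_mono) auto
    also have "p n \<le> 1 / n"
    proof -
      have "p n = real n powr (-\<eta>) / n" using n powr_minus_one_plus[of n \<eta>] by (simp only: p_def)
      also have "real n powr (-\<eta>) \<le> real n powr 0" using n assms by (intro powr_mono) auto
      finally show ?thesis using n by (simp add: divide_right_mono)
    qed
    finally show "(\<Sum>k=1..n. real k powr (- (1 + \<eta>)) / real (max (n - k) 1)) \<le> (3 * suminf p + 1) / real n"
      by (simp add: p_def add_divide_distrib)
  qed (use S0 in simp)
qed

text \<open>By \<open>total\<close> alone, the smallest of \<open>\<delta>\<^sub>1, \<dots>, \<delta>\<^sub>n\<close> has the claimed order. The hypothesis \<open>tail\<close> limits the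
  average rise of \<open>\<delta>\<close> after each index and thereby carries the bound over to the last index.\<close>

theorem last_iterate_rate:
  fixes \<delta> \<epsilon> \<sigma> :: "nat \<Rightarrow> real"
  assumes \<epsilon>: "c > 0" "\<theta> > 0" "\<And>k. k \<ge> 1 \<Longrightarrow> \<epsilon> k = c * real k powr (- \<theta>)"
    and \<delta>: "\<And>k. \<delta> k \<ge> 0"
    and \<sigma>: "\<eta> > 0" "s \<ge> 0" "\<And>k. k \<ge> 1 \<Longrightarrow> 0 \<le> \<sigma> k" "\<And>k. k \<ge> 1 \<Longrightarrow> \<sigma> k \<le> s * real k powr (- (1 + \<eta>))"
    and tail: "\<And>i n. 1 \<le> i \<Longrightarrow> i \<le> n \<Longrightarrow> (\<Sum>k=i..n. \<epsilon> k * (\<delta> k - \<delta> i)) \<le> (\<Sum>k=i..n. \<sigma> k)"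
    and total: "\<And>n. (\<Sum>k=1..n. \<epsilon> k * \<delta> k) \<le> C"
  shows "\<delta> \<in> O(\<lambda>n. real n powr (\<theta> - 1))"
proof -
  define x where "x k = \<epsilon> k * \<delta> k" for k
  obtain Z where Z: "Z \<ge> 0" and Zle: "\<And>n. n \<ge> 1 \<Longrightarrow>
      (\<Sum>k=1..n. real k powr (- (1 + \<eta>)) / real (max (n - k) 1)) \<le> Z / real n"
    using powr_convolution_sum_bound[OF \<sigma>(1)] by auto
  have dec: "\<epsilon> k \<le> \<epsilon> i" if "1 \<le> i" "i \<le> k" for i k
    using that \<epsilon> by (simp add: powr_mono2')
  have x_le: "x n \<le> (C + s * Z) / n" if n: "n \<ge> 1" for n
  proof -
    have "(\<Sum>k=i..n. x k) \<le> real (n - i + 1) * x i + (\<Sum>k=i..n. \<sigma> k)" if i: "1 \<le> i" "i \<le> n" for i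
    proof -
      have "(\<Sum>k=i..n. x k) = (\<Sum>k=i..n. \<epsilon> k * (\<delta> k - \<delta> i)) + (\<Sum>k=i..n. \<epsilon> k * \<delta> i)"
        by (simp add: x_def sum.distrib[symmetric] algebra_simps)
      also have "(\<Sum>k=i..n. \<epsilon> k * \<delta> i) \<le> (\<Sum>k=i..n. x i)"
        unfolding x_def using \<delta> dec i by (intro sum_mono mult_right_mono) auto
      also have "\<dots> = real (n - i + 1) * x i" using i by (simp add: Suc_diff_le)
      finally show ?thesis using tail[OF i] by linarith
    qed
    then have "x n \<le> (\<Sum>k=1..n. x k) / real n +
        (\<Sum>k=1..n. \<sigma> k * (1 / real (max (n - k) 1) - 1 / real n))"
      by (rule last_term_le_average[OF _ n])
    also have "(\<Sum>k=1..n. \<sigma> k * (1 / real (max (n - k) 1) - 1 / real n)) \<le>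
        (\<Sum>k=1..n. s * (real k powr (- (1 + \<eta>)) / real (max (n - k) 1)))"
    proof (rule sum_mono)
      fix k assume k: "k \<in> {1..n}"
      have "\<sigma> k * (1 / real (max (n - k) 1) - 1 / real n) \<le> \<sigma> k * (1 / real (max (n - k) 1))"
        using k \<sigma>(3)[of k] by (intro mult_left_mono) auto
      also have "\<dots> \<le> (s * real k powr (- (1 + \<eta>))) * (1 / real (max (n - k) 1))"
        using k \<sigma>(4)[of k] by (intro mult_right_mono) auto
      finally show "\<sigma> k * (1 / real (max (n - k) 1) - 1 / real n) \<le>
          s * (real k powr (- (1 + \<eta>)) / real (max (n - k) 1))" by simp
    qed
    also have "\<dots> \<le> s * (Z / n)"
      unfolding sum_distrib_left[symmetric] by (intro mult_left_mono Zle n \<sigma>)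
    also have "(\<Sum>k=1..n. x k) / real n \<le> C / n"
      using total[of n] by (intro divide_right_mono) (auto simp: x_def)
    finally show ?thesis by (simp add: add_divide_distrib)
  qed
  have "norm (\<delta> n) \<le> ((C + s * Z) / c) * norm (real n powr (\<theta> - 1))" if n: "n \<ge> 1" for n
  proof -
    have "(c * real n powr (- \<theta>)) * \<delta> n \<le> (C + s * Z) / n"
      using x_le[OF n] \<epsilon>(3)[OF n] by (simp add: x_def)
    then have "\<delta> n \<le> (C + s * Z) / n / (c * real n powr (- \<theta>))"
      using n \<epsilon>(1) by (simp add: pos_le_divide_eq ac_simps)
    also have "\<dots> = ((C + s * Z) / c) * real n powr (\<theta> - 1)"
      using n by (simp add: powr_diff powr_minus divide_simps)
    finally show ?thesis using \<delta>[of n] by simp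
  qed
  then show ?thesis
    by (intro bigoI[of _ "(C + s * Z) / c"]) (auto simp: eventually_at_top_linorder intro!: exI[of _ 1])
qed


section \<open>Expectations along the iterates\<close>

lemma power2_add_le: "(x + y)\<^sup>2 \<le> 2 * x\<^sup>2 + 2 * (y::real)\<^sup>2"
  using zero_le_power2[of "x - y"] by (simp add: power2_eq_square algebra_simps)

lemma norm_diff_power2_le: "(norm (u - v))\<^sup>2 \<le> 2 * (norm u)\<^sup>2 + 2 * (norm v)\<^sup>2"
proof -
  have "(norm (u - v))\<^sup>2 \<le> (norm u + norm v)\<^sup>2"
    by (intro power_mono norm_triangle_ineq4) simp
  also have "\<dots> \<le> 2 * (norm u)\<^sup>2 + 2 * (norm v)\<^sup>2" by (rule power2_add_le)
  finally show ?thesis .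
qed

text \<open>What the analysis of a single step requires; \<open>Q\<close> is an arbitrary sequence of almost sure bounds on the
  errors.\<close>

locale app_bounded_errors =
  app_algorithm P Uad jC jS K gradK W Ws eps R u0 G U + strongly_convex_kernel K gradK b LK
  for P :: "'a measure"
    and Uad :: "'u::{banach, second_countable_topology} set"
    and jC jS :: "'u \<Rightarrow> 'w::{topological_ab_group_add, real_vector} \<Rightarrow> real"
    and K :: "'u \<Rightarrow> real"
    and gradK :: "'u \<Rightarrow> ('u \<Rightarrow>\<^sub>L real)"
    and W :: "'a \<Rightarrow> 'w"
    and Ws :: "nat \<Rightarrow> 'a \<Rightarrow> 'w"
    and eps :: "nat \<Rightarrow> real"
    and R :: "nat \<Rightarrow> 'a \<Rightarrow> ('u \<Rightarrow>\<^sub>L real)"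
    and u0 :: 'u
    and G :: "nat \<Rightarrow> 'a \<Rightarrow> ('u \<Rightarrow>\<^sub>L real)"
    and U :: "nat \<Rightarrow> 'a \<Rightarrow> 'u"
    and b LK :: real +
  fixes c1 c2 d1 d2 :: real and Q :: "nat \<Rightarrow> real"
  assumes growth_nonneg: "0 \<le> c1" "0 \<le> c2" "0 \<le> d1" "0 \<le> d2"
    and jC_growth: "\<And>u w r. u \<in> Uad \<Longrightarrow> r \<in> subdifferential (\<lambda>v. jC v w) u \<Longrightarrow>
                 norm r \<le> c1 * norm u + c2"
    and jS_growth: "\<And>u w s. u \<in> Uad \<Longrightarrow> s \<in> subdifferential (\<lambda>v. jS v w) u \<Longrightarrow>
                 norm s \<le> d1 * norm u + d2"
    and Q_nonneg: "\<And>k. 0 \<le> Q k"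
    and R_le_Q: "\<And>k. AE \<omega> in P. norm (R k \<omega>) \<le> Q k"
begin

abbreviation j :: "'u \<Rightarrow> 'w \<Rightarrow> real" where "j u w \<equiv> jC u w + jS u w"
abbreviation J :: "'u \<Rightarrow> real" where "J \<equiv> expected_cost P jC jS W"
abbreviation F :: "nat \<Rightarrow> 'a measure" where "F \<equiv> past P Ws"

text \<open>A bound on the norm of the sum of a subgradient of \<open>j\<^sup>C\<close> and a subgradient of \<open>j\<^sup>\<Sigma>\<close> at a feasible \<open>u\<close>.\<close>

definition slope :: "'u \<Rightarrow> real" where "slope u = (c1 + d1) * norm u + (c2 + d2)"

lemma slope_power2: "(slope u)\<^sup>2 \<le> 2 * (c1 + d1)\<^sup>2 * (norm u)\<^sup>2 + 2 * (c2 + d2)\<^sup>2"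
  using power2_add_le[of "(c1 + d1) * norm u" "c2 + d2"] by (simp add: slope_def power_mult_distrib)

lemma iterate_feasible: "\<omega> \<in> space P \<Longrightarrow> U k \<omega> \<in> Uad"
  using U_step[of \<omega> "k - 1"] U_init u0_feasible by (cases k) (auto simp: is_arg_min_def)

lemma jS_subgradient: "\<exists>s. s \<in> subdifferential (\<lambda>v. jS v w) u"
proof -
  have "lsc (\<lambda>v. jS v w)"
    unfolding lsc_def
  proof
    fix a
    have "open ((\<lambda>v. (v, w)) -` {z. a < (\<lambda>(u, w). jS u w) z})"
      using jS_lsc unfolding lsc_def by (intro open_vimage continuous_intros) blast+
    then show "open {v. a < jS v w}" by (simp add: vimage_def)
  qed
  then have "subdifferential (\<lambda>v. jS v w) u \<noteq> {}"
    by (rule convex_lsc_subdifferentiable[OF jS_convex])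
  then show ?thesis by auto
qed

lemma j_decrease_le:
  assumes u: "u \<in> Uad"
  shows "j u w - j v w \<le> slope u * norm (u - v)"
proof -
  obtain r where r: "r \<in> subdifferential (\<lambda>v. jC v w) u"
    using jC_subdifferentiable[of w] u by auto
  obtain s where s: "s \<in> subdifferential (\<lambda>v. jS v w) u" using jS_subgradient by auto
  have "jC u w + r (v - u) \<le> jC v w" "jS u w + s (v - u) \<le> jS v w"
    using r s by (auto simp: subdifferential_def)
  then have "j u w - j v w \<le> (r + s) (u - v)"
    by (simp add: blinfun.add_left blinfun.diff_right)
  also have "\<dots> \<le> norm (r + s) * norm (u - v)" using norm_blinfun[of "r + s" "u - v"] by simp
  also have "\<dots> \<le> slope u * norm (u - v)"
  proof (rule mult_right_mono)
    have "norm (r + s) \<le> norm r + norm s" by (rule norm_triangle_ineq)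
    with jC_growth[OF u r] jS_growth[OF u s] show "norm (r + s) \<le> slope u"
      by (simp add: slope_def algebra_simps)
  qed simp
  finally show ?thesis .
qed

text \<open>Differences of the integrand grow at most quadratically, uniformly in \<open>w\<close>. Second moments of the two
  points thus suffice to integrate the difference.\<close>

lemma j_increment_bound:
  assumes "u \<in> Uad" "v \<in> Uad"
  shows "\<bar>j u w - j v w\<bar> \<le>
    2 * (c1 + d1) * ((norm u)\<^sup>2 + (norm v)\<^sup>2) + (c2 + d2) * (2 + (norm u)\<^sup>2 + (norm v)\<^sup>2)"
proof -
  have "\<bar>j u w - j v w\<bar> \<le> max (slope u) (slope v) * norm (u - v)"
  proof (rule abs_leI)
    have "slope u * norm (u - v) \<le> max (slope u) (slope v) * norm (u - v)"
      by (intro mult_right_mono) auto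
    with j_decrease_le[OF assms(1), of w v]
    show "j u w - j v w \<le> max (slope u) (slope v) * norm (u - v)" by linarith
    have "slope v * norm (u - v) \<le> max (slope u) (slope v) * norm (u - v)"
      by (intro mult_right_mono) auto
    with j_decrease_le[OF assms(2), of w u]
    show "- (j u w - j v w) \<le> max (slope u) (slope v) * norm (u - v)"
      by (simp add: norm_minus_commute)
  qed
  also have "\<dots> \<le> ((c1 + d1) * (norm u + norm v) + (c2 + d2)) * (norm u + norm v)"
  proof (intro mult_mono norm_triangle_ineq4)
    have "(c1 + d1) * norm u \<le> (c1 + d1) * (norm u + norm v)"
      "(c1 + d1) * norm v \<le> (c1 + d1) * (norm u + norm v)"
      using growth_nonneg by (auto intro!: mult_left_mono)
    then show "max (slope u) (slope v) \<le> (c1 + d1) * (norm u + norm v) + (c2 + d2)"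
      unfolding slope_def by simp
  qed (use growth_nonneg in auto)
  also have "\<dots> = (c1 + d1) * (norm u + norm v)\<^sup>2 + (c2 + d2) * (norm u + norm v)"
    by (simp add: power2_eq_square algebra_simps)
  also have "\<dots> \<le> (c1 + d1) * (2 * (norm u)\<^sup>2 + 2 * (norm v)\<^sup>2) + (c2 + d2) * (2 + (norm u)\<^sup>2 + (norm v)\<^sup>2)"
  proof (rule add_mono; rule mult_left_mono)
    show "(norm u + norm v)\<^sup>2 \<le> 2 * (norm u)\<^sup>2 + 2 * (norm v)\<^sup>2" by (rule power2_add_le)
    have "x \<le> 1 + x\<^sup>2" for x :: real
      using zero_le_power2[of "x - 1 / 2"] by (simp add: power2_eq_square algebra_simps)
    from this[of "norm u"] this[of "norm v"]
    show "norm u + norm v \<le> 2 + (norm u)\<^sup>2 + (norm v)\<^sup>2" by linarith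
  qed (use growth_nonneg in auto)
  finally show ?thesis by (simp add: algebra_simps)
qed

lemma j_measurable: "(\<lambda>z. j (fst z) (snd z)) \<in> borel_measurable (borel \<Otimes>\<^sub>M borel)"
  using lsc_measurable_pair[OF jC_lsc] lsc_measurable_pair[OF jS_lsc]
  by (simp add: case_prod_beta')

lemma Ws_measurable: "i \<ge> 1 \<Longrightarrow> Ws i \<in> borel_measurable P"
  using samples_indep by (auto simp: indep_vars_def)

lemma space_past [simp]: "space (F k) = space P"
  by (simp add: past_def space_measure_of_conv)

lemma sets_past:
  "sets (F k) = sigma_sets (space P) (\<Union>i\<in>{1..k}. {Ws i -` A \<inter> space P |A. A \<in> sets borel})"
  unfolding past_def by (rule sets_measure_of) auto

lemma past_mono: "k \<le> l \<Longrightarrow> sets (F k) \<subseteq> sets (F l)"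
  unfolding sets_past by (intro sigma_sets_mono') (auto, force)

lemma past_subset: "sets (F k) \<subseteq> sets P"
  unfolding sets_past using Ws_measurable by (intro sets.sigma_sets_subset) auto

lemma past_measurable_mono:
  "X \<in> borel_measurable (F k) \<Longrightarrow> k \<le> l \<Longrightarrow> X \<in> borel_measurable (F l)"
  using past_mono[of k l] by (auto simp: measurable_def)

lemma past_measurable_imp_measurable: "X \<in> borel_measurable (F k) \<Longrightarrow> X \<in> borel_measurable P"
  using past_subset[of k] by (auto simp: measurable_def)

text \<open>Independence of the single samples extends to the \<open>\<sigma>\<close>-fields generated by the disjoint groups
  \<open>{1..k}\<close> and \<open>{k + 1}\<close>.\<close>

lemma past_indep_next_sample:
  "indep_set (sets (F k)) {Ws (Suc k) -` A \<inter> space P |A. A \<in> sets borel}"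
proof -
  define E where "E i = {Ws i -` A \<inter> space P |A. A \<in> sets (borel :: 'w measure)}" for i
  define I where "I = case_bool {1..k} {Suc k}"
  have ind: "indep_sets (\<lambda>c. sigma_sets (space P) (\<Union>i\<in>I c. E i)) UNIV"
  proof (rule indep_sets_collect_sigma)
    have "indep_sets E {1..}" using samples_indep unfolding indep_vars_def2 E_def by simp
    then show "indep_sets E (\<Union>c\<in>UNIV. I c)"
      by (rule indep_sets_mono_index[rotated]) (auto simp: I_def split: bool.splits)
    show "Int_stable (E i)" for i
      unfolding Int_stable_def E_def
    proof safe
      fix A B :: "'w set" assume "A \<in> sets borel" "B \<in> sets borel"
      then show "\<exists>C. Ws i -` A \<inter> space P \<inter> (Ws i -` B \<inter> space P) = Ws i -` C \<inter> space P \<and> C \<in> sets borel"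
        by (intro exI[of _ "A \<inter> B"]) auto
    qed
    show "disjoint_family_on I UNIV"
      by (auto simp: disjoint_family_on_def I_def split: bool.splits)
  qed
  show ?thesis
    unfolding indep_set_def
  proof (rule indep_sets_mono_sets[OF ind])
    show "case_bool (sets (F k)) {Ws (Suc k) -` A \<inter> space P |A. A \<in> sets borel} c
        \<subseteq> sigma_sets (space P) (\<Union>i\<in>I c. E i)" for c
      by (cases c) (auto simp: I_def E_def sets_past)
  qed
qed

lemma distr_past_next_sample:
  fixes X :: "'a \<Rightarrow> 'x::topological_space"
  assumes X: "X \<in> borel_measurable (F k)"
  shows "distr P borel X \<Otimes>\<^sub>M distr P borel (Ws (Suc k))
    = distr P (borel \<Otimes>\<^sub>M borel) (\<lambda>\<omega>. (X \<omega>, Ws (Suc k) \<omega>))"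
proof -
  have [measurable]: "X \<in> borel_measurable P" using X by (rule past_measurable_imp_measurable)
  have [measurable]: "Ws (Suc k) \<in> borel_measurable P" by (rule Ws_measurable) simp
  show ?thesis
  proof (rule pair_measure_eqI)
    fix A B assume "A \<in> sets (distr P borel X)" "B \<in> sets (distr P borel (Ws (Suc k)))"
    then have [measurable]: "A \<in> sets borel" "B \<in> sets borel" by auto
    have "X -` A \<inter> space P \<in> sets (F k)" using X by (auto simp: measurable_def)
    then have "prob ((X -` A \<inter> space P) \<inter> (Ws (Suc k) -` B \<inter> space P)) =
        prob (X -` A \<inter> space P) * prob (Ws (Suc k) -` B \<inter> space P)"
      using past_indep_next_sample[of k] \<open>B \<in> sets borel\<close> unfolding indep_sets2_eq by blast
    moreover have "(\<lambda>\<omega>. (X \<omega>, Ws (Suc k) \<omega>)) -` (A \<times> B) \<inter> space P =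
        (X -` A \<inter> space P) \<inter> (Ws (Suc k) -` B \<inter> space P)" by auto
    ultimately show "emeasure (distr P borel X) A * emeasure (distr P borel (Ws (Suc k))) B =
        emeasure (distr P (borel \<Otimes>\<^sub>M borel) (\<lambda>\<omega>. (X \<omega>, Ws (Suc k) \<omega>))) (A \<times> B)"
      by (simp add: emeasure_distr emeasure_eq_measure ennreal_mult')
  qed (auto intro!: prob_space_distr prob_space_imp_sigma_finite)
qed

lemma integral_sample:
  fixes f :: "'w \<Rightarrow> real"
  assumes [measurable]: "f \<in> borel_measurable borel"
  shows "(\<integral>w. f w \<partial>distr P borel (Ws (Suc k))) = (\<integral>\<omega>. f (W \<omega>) \<partial>P)"
proof -
  have [measurable]: "W \<in> borel_measurable P" by (rule W_measurable)
  show ?thesis using samples_distr[of "Suc k"] by (simp add: integral_distr)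
qed

text \<open>The random points that may serve as reference points at step \<open>k\<close>. They must not anticipate the sample
  of that step, and their second moments make the increments of the integrand integrable.\<close>

definition admissible :: "nat \<Rightarrow> ('a \<Rightarrow> 'u) \<Rightarrow> bool" where
  "admissible k X \<longleftrightarrow> X \<in> borel_measurable (F k) \<and> (\<forall>\<omega>\<in>space P. X \<omega> \<in> Uad) \<and>
     integrable P (\<lambda>\<omega>. (norm (X \<omega>))\<^sup>2)"

lemma admissible_mono: "admissible k X \<Longrightarrow> k \<le> l \<Longrightarrow> admissible l X"
  using past_measurable_mono by (auto simp: admissible_def)

lemma admissible_const: "u \<in> Uad \<Longrightarrow> admissible k (\<lambda>_. u)"
  by (simp add: admissible_def)

lemma admissible_measurable: "admissible k X \<Longrightarrow> X \<in> borel_measurable P"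
  using past_measurable_imp_measurable by (auto simp: admissible_def)

text \<open>The pair \<open>(X, Y)\<close> depends on the past only, so its joint law with the next sample is a product measure.
  Fubini's theorem then integrates out the sample first. Working with the difference of two values makes
  the integrand integrable by \<open>j_increment_bound\<close>, whereas \<open>j (X \<omega>) (Ws (Suc k) \<omega>)\<close> alone is not bounded in
  terms of \<open>X\<close>.\<close>

lemma expected_increment:
  assumes X: "admissible k X" and Y: "admissible k Y"
  defines "f \<equiv> \<lambda>\<omega>. j (X \<omega>) (Ws (Suc k) \<omega>) - j (Y \<omega>) (Ws (Suc k) \<omega>)"
  shows "integrable P f" "integrable P (\<lambda>\<omega>. J (X \<omega>) - J (Y \<omega>))"
    "(\<integral>\<omega>. f \<omega> \<partial>P) = (\<integral>\<omega>. (J (X \<omega>) - J (Y \<omega>)) \<partial>P)"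
proof -
  have [measurable]: "X \<in> borel_measurable P" "Y \<in> borel_measurable P"
    using X Y by (auto intro: admissible_measurable)
  have [measurable]: "Ws (Suc k) \<in> borel_measurable P" by (rule Ws_measurable) simp
  have [measurable]: "W \<in> borel_measurable P" by (rule W_measurable)
  define Z where "Z \<omega> = (X \<omega>, Y \<omega>)" for \<omega>
  have Z: "Z \<in> borel_measurable (F k)"
    using X Y unfolding Z_def admissible_def by (intro borel_measurable_Pair) auto
  then have [measurable]: "Z \<in> borel_measurable P" by (rule past_measurable_imp_measurable)
  define g where "g = (\<lambda>(z, w). j (fst z) w - j (snd z) w)"
  have g [measurable]: "g \<in> borel_measurable (borel \<Otimes>\<^sub>M borel)"
  proof -
    have 1: "(\<lambda>z. (fst (fst z), snd z)) \<in> (borel :: ('u \<times> 'u) measure) \<Otimes>\<^sub>M (borel :: 'w measure) \<rightarrow>\<^sub>M borel \<Otimes>\<^sub>M borel"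
      and 2: "(\<lambda>z. (snd (fst z), snd z)) \<in> (borel :: ('u \<times> 'u) measure) \<Otimes>\<^sub>M (borel :: 'w measure) \<rightarrow>\<^sub>M borel \<Otimes>\<^sub>M borel"
      by (simp_all add: borel_prod[symmetric])
    show ?thesis
      using borel_measurable_diff[OF measurable_compose[OF 1 j_measurable] measurable_compose[OF 2 j_measurable]]
      by (simp add: g_def case_prod_beta')
  qed
  have f_eq: "f = (\<lambda>\<omega>. g (Z \<omega>, Ws (Suc k) \<omega>))" by (simp add: f_def g_def Z_def)
  have fm: "f \<in> borel_measurable P" unfolding f_eq by measurable
  show f_int: "integrable P f"
  proof (rule Bochner_Integration.integrable_bound[OF _ fm])
    let ?B = "\<lambda>\<omega>. 2 * (c1 + d1) * ((norm (X \<omega>))\<^sup>2 + (norm (Y \<omega>))\<^sup>2) +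
        (c2 + d2) * (2 + (norm (X \<omega>))\<^sup>2 + (norm (Y \<omega>))\<^sup>2)"
    show "integrable P ?B" using X Y by (auto simp: admissible_def)
    show "AE \<omega> in P. norm (f \<omega>) \<le> norm (?B \<omega>)"
    proof (rule AE_I2)
      fix \<omega> assume "\<omega> \<in> space P"
      then have "\<bar>f \<omega>\<bar> \<le> ?B \<omega>" unfolding f_def
        using X Y by (intro j_increment_bound) (auto simp: admissible_def)
      then show "norm (f \<omega>) \<le> norm (?B \<omega>)" by simp
    qed
  qed
  let ?Z = "distr P borel Z" and ?W = "distr P borel (Ws (Suc k))"
  have pair: "?Z \<Otimes>\<^sub>M ?W = distr P (borel \<Otimes>\<^sub>M borel) (\<lambda>\<omega>. (Z \<omega>, Ws (Suc k) \<omega>))"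
    by (rule distr_past_next_sample[OF Z])
  interpret Z: prob_space ?Z by (rule prob_space_distr) measurable
  interpret W: prob_space ?W by (rule prob_space_distr) measurable
  interpret ZW: pair_prob_space ?Z ?W ..
  have gi: "integrable (?Z \<Otimes>\<^sub>M ?W) g"
    unfolding pair using f_int by (subst integrable_distr_eq) (auto simp: f_eq)
  have inner: "(\<integral>w. g (Z \<omega>, w) \<partial>?W) = J (X \<omega>) - J (Y \<omega>)" if "\<omega> \<in> space P" for \<omega>
  proof -
    have "(\<lambda>w. g (Z \<omega>, w)) \<in> borel_measurable borel" by measurable
    then have "(\<integral>w. g (Z \<omega>, w) \<partial>?W) = (\<integral>\<omega>'. g (Z \<omega>, W \<omega>') \<partial>P)" by (rule integral_sample)
    also have "\<dots> = J (X \<omega>) - J (Y \<omega>)"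
      using X Y that jC_integrable jS_integrable
      by (simp add: g_def Z_def expected_cost_def admissible_def)
    finally show ?thesis .
  qed
  have "integrable ?Z (\<lambda>z. \<integral>w. g (z, w) \<partial>?W)" using ZW.integrable_fst'[OF gi] .
  then have "integrable P (\<lambda>\<omega>. \<integral>w. g (Z \<omega>, w) \<partial>?W)" by (simp add: integrable_distr_eq)
  then show "integrable P (\<lambda>\<omega>. J (X \<omega>) - J (Y \<omega>))"
    by (subst (asm) Bochner_Integration.integrable_cong[OF refl inner]) auto
  have "(\<integral>\<omega>. f \<omega> \<partial>P) = integral\<^sup>L (?Z \<Otimes>\<^sub>M ?W) g"
    unfolding pair by (subst integral_distr) (auto simp: f_eq)
  also have "\<dots> = (\<integral>z. (\<integral>w. g (z, w) \<partial>?W) \<partial>?Z)" using ZW.integral_fst'[OF gi] by simp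
  also have "\<dots> = (\<integral>\<omega>. (\<integral>w. g (Z \<omega>, w) \<partial>?W) \<partial>P)"
    by (subst integral_distr) (auto intro: borel_measurable_integrable)
  also have "\<dots> = (\<integral>\<omega>. (J (X \<omega>) - J (Y \<omega>)) \<partial>P)"
    by (rule Bochner_Integration.integral_cong[OF refl inner])
  finally show "(\<integral>\<omega>. f \<omega> \<partial>P) = (\<integral>\<omega>. (J (X \<omega>) - J (Y \<omega>)) \<partial>P)" .
qed


section \<open>Expected descent and the optimality gap\<close>

text \<open>The first summand comes from the pairing of the error \<open>R\<^sub>k\<close> with the distance to the reference point. The
  other two are the squares left by Young's inequality in \<open>auxiliary_step\<close>, one for the subgradients and
  one for \<open>R\<^sub>k\<close>.\<close>

definition noise :: "nat \<Rightarrow> real" where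
  "noise k = eps k * Q k + (eps k)\<^sup>2 + (eps k * Q k)\<^sup>2"

lemma noise_nonneg: "0 \<le> noise k"
  using eps_pos[of k] Q_nonneg[of k] by (simp add: noise_def)

text \<open>The inequality of \<open>auxiliary_step\<close> along one sample path. All error terms are collected under the single
  deterministic factor \<open>noise k\<close>, at the price of squares of norms, which have finite expectation.\<close>

lemma pathwise_step:
  assumes \<omega>: "\<omega> \<in> space P" and v: "v \<in> Uad" and R: "norm (R k \<omega>) \<le> Q k"
  shows "D v (U (Suc k) \<omega>) \<le> D v (U k \<omega>)
    + eps k * (j v (Ws (Suc k) \<omega>) - j (U k \<omega>) (Ws (Suc k) \<omega>))
    + noise k * (1 + (norm (v - U k \<omega>))\<^sup>2
        + (2 * (c1 + d1)\<^sup>2 * (norm (U k \<omega>))\<^sup>2 + 2 * (c2 + d2)\<^sup>2 + 1) / b)"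
proof -
  let ?w = "Ws (Suc k) \<omega>" and ?u = "U k \<omega>" and ?e = "eps k" and ?r = "norm (R k \<omega>)"
  have e: "?e > 0" by (rule eps_pos)
  have u: "?u \<in> Uad" using \<omega> by (rule iterate_feasible)
  obtain s where s: "s \<in> subdifferential (\<lambda>v. jS v ?w) ?u" using jS_subgradient by auto
  have "norm (G k \<omega>) \<le> c1 * norm ?u + c2" "norm s \<le> d1 * norm ?u + d2"
    using jC_growth[OF u G_subgradient[OF \<omega>]] jS_growth[OF u s] by auto
  then have H: "norm (G k \<omega>) + norm s \<le> slope ?u" by (simp add: slope_def algebra_simps)
  have 1: "D v (U (Suc k) \<omega>) \<le> D v ?u + ?e * (j v ?w - j ?u ?w)
      + ?e * ?r * norm (v - ?u) + (?e * (slope ?u + ?r))\<^sup>2 / (2 * b)"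
    by (rule auxiliary_step[where S = Uad and jS = jS and jC = jC, OF Uad_convex jS_convex e
          U_step[OF \<omega>] v G_subgradient[OF \<omega>] s H])
  have noise: "?e * Q k \<le> noise k" "?e\<^sup>2 \<le> noise k" "(?e * Q k)\<^sup>2 \<le> noise k - ?e\<^sup>2"
    using e Q_nonneg[of k] by (simp_all add: noise_def)
  have "norm (v - ?u) \<le> 1 + (norm (v - ?u))\<^sup>2"
    using zero_le_power2[of "norm (v - ?u) - 1 / 2"] by (simp add: power2_eq_square algebra_simps)
  moreover have "?e * ?r \<le> noise k"
    using mult_left_mono[OF R, of ?e] e noise(1) by linarith
  ultimately have 2: "?e * ?r * norm (v - ?u) \<le> noise k * (1 + (norm (v - ?u))\<^sup>2)"
    using noise_nonneg[of k] by (intro mult_mono) auto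
  have "(?e * (slope ?u + ?r))\<^sup>2 \<le> 2 * (?e * slope ?u)\<^sup>2 + 2 * (?e * ?r)\<^sup>2"
    using power2_add_le[of "?e * slope ?u" "?e * ?r"] by (simp add: distrib_left)
  also have "(?e * ?r)\<^sup>2 \<le> (?e * Q k)\<^sup>2"
    using R e by (intro power_mono mult_left_mono) auto
  also have "(?e * slope ?u)\<^sup>2 \<le> noise k * (slope ?u)\<^sup>2"
    using noise(2) by (simp add: power_mult_distrib mult_right_mono)
  also have "(?e * Q k)\<^sup>2 \<le> noise k" using noise(3) zero_le_power2[of ?e] by linarith
  also have "noise k * (slope ?u)\<^sup>2 \<le> noise k * (2 * (c1 + d1)\<^sup>2 * (norm ?u)\<^sup>2 + 2 * (c2 + d2)\<^sup>2)"
    by (intro mult_left_mono slope_power2 noise_nonneg)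
  finally have "(?e * (slope ?u + ?r))\<^sup>2 \<le>
      2 * (noise k * (2 * (c1 + d1)\<^sup>2 * (norm ?u)\<^sup>2 + 2 * (c2 + d2)\<^sup>2 + 1))"
    by (simp add: algebra_simps)
  then have "(?e * (slope ?u + ?r))\<^sup>2 / (2 * b) \<le>
      2 * (noise k * (2 * (c1 + d1)\<^sup>2 * (norm ?u)\<^sup>2 + 2 * (c2 + d2)\<^sup>2 + 1)) / (2 * b)"
    using b_pos by (intro divide_right_mono) auto
  then have 3: "(?e * (slope ?u + ?r))\<^sup>2 / (2 * b) \<le>
      noise k * ((2 * (c1 + d1)\<^sup>2 * (norm ?u)\<^sup>2 + 2 * (c2 + d2)\<^sup>2 + 1) / b)"
    by simp
  from 1 2 3 show ?thesis by (simp add: distrib_left)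
qed

lemma bregman_measurable:
  assumes "X \<in> borel_measurable P" "Y \<in> borel_measurable P"
  shows "(\<lambda>\<omega>. D (X \<omega>) (Y \<omega>)) \<in> borel_measurable P"
proof -
  have "(\<lambda>\<omega>. (X \<omega>, Y \<omega>)) \<in> borel_measurable P"
    using assms by (rule borel_measurable_Pair)
  from measurable_compose[OF this borel_measurable_continuous_onI[OF continuous_bregman]]
  show ?thesis by simp
qed

lemma integrable_norm_diff_power2:
  assumes [measurable]: "X \<in> borel_measurable P" "Y \<in> borel_measurable P"
    and i: "integrable P (\<lambda>\<omega>. (norm (X \<omega> :: 'u))\<^sup>2)" "integrable P (\<lambda>\<omega>. (norm (Y \<omega>))\<^sup>2)"
  shows "integrable P (\<lambda>\<omega>. (norm (X \<omega> - Y \<omega>))\<^sup>2)"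
proof (rule Bochner_Integration.integrable_bound)
  show "integrable P (\<lambda>\<omega>. 2 * (norm (X \<omega>))\<^sup>2 + 2 * (norm (Y \<omega>))\<^sup>2)" using i by simp
  show "AE \<omega> in P. norm ((norm (X \<omega> - Y \<omega>))\<^sup>2) \<le> norm (2 * (norm (X \<omega>))\<^sup>2 + 2 * (norm (Y \<omega>))\<^sup>2)"
    using norm_diff_power2_le by (intro AE_I2) simp
qed measurable

lemma integrable_bregman:
  assumes X: "X \<in> borel_measurable P" and Y: "Y \<in> borel_measurable P"
    and i: "integrable P (\<lambda>\<omega>. (norm (X \<omega>))\<^sup>2)" "integrable P (\<lambda>\<omega>. (norm (Y \<omega>))\<^sup>2)"
  shows "integrable P (\<lambda>\<omega>. D (X \<omega>) (Y \<omega>))"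
proof (rule Bochner_Integration.integrable_bound)
  show "integrable P (\<lambda>\<omega>. LK * (norm (X \<omega> - Y \<omega>))\<^sup>2)"
    using integrable_norm_diff_power2[OF assms] by simp
  show "AE \<omega> in P. norm (D (X \<omega>) (Y \<omega>)) \<le> norm (LK * (norm (X \<omega> - Y \<omega>))\<^sup>2)"
    using bregman_nonneg bregman_upper LK_pos by (intro AE_I2) simp
qed (rule bregman_measurable[OF X Y])

lemma iterate_measurable: "U k \<in> borel_measurable P"
  using past_measurable_imp_measurable[OF U_adapted] .

text \<open>Integrability of \<open>D V U\<^sub>k\<^sub>+\<^sub>1\<close> is a conclusion here: it is nonnegative and the pathwise bound
  involves step \<open>k\<close> and its sample only. This lets the moments of the iterates be established by induction.\<close>

lemma expected_step:
  assumes V: "admissible k V" and Uk: "admissible k (U k)"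
  shows "integrable P (\<lambda>\<omega>. D (V \<omega>) (U (Suc k) \<omega>))"
    and "(\<integral>\<omega>. D (V \<omega>) (U (Suc k) \<omega>) \<partial>P) \<le> (\<integral>\<omega>. D (V \<omega>) (U k \<omega>) \<partial>P)
      - eps k * (\<integral>\<omega>. (J (U k \<omega>) - J (V \<omega>)) \<partial>P)
      + noise k * (1 + (\<integral>\<omega>. (norm (V \<omega> - U k \<omega>))\<^sup>2 \<partial>P)
          + (2 * (c1 + d1)\<^sup>2 * (\<integral>\<omega>. (norm (U k \<omega>))\<^sup>2 \<partial>P) + 2 * (c2 + d2)\<^sup>2 + 1) / b)"
proof -
  let ?w = "Ws (Suc k)"
  have VM: "V \<in> borel_measurable P" using V by (rule admissible_measurable)
  have V2: "integrable P (\<lambda>\<omega>. (norm (V \<omega>))\<^sup>2)" and U2: "integrable P (\<lambda>\<omega>. (norm (U k \<omega>))\<^sup>2)"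
    using V Uk by (auto simp: admissible_def)
  note inc = expected_increment[OF Uk V]
  define B where "B \<omega> = D (V \<omega>) (U k \<omega>)
    - eps k * (j (U k \<omega>) (?w \<omega>) - j (V \<omega>) (?w \<omega>))
    + noise k * (1 + (norm (V \<omega> - U k \<omega>))\<^sup>2
        + (2 * (c1 + d1)\<^sup>2 * (norm (U k \<omega>))\<^sup>2 + 2 * (c2 + d2)\<^sup>2 + 1) / b)" for \<omega>
  have i: "integrable P (\<lambda>\<omega>. D (V \<omega>) (U k \<omega>))" "integrable P (\<lambda>\<omega>. (norm (V \<omega> - U k \<omega>))\<^sup>2)"
    using integrable_bregman[OF VM iterate_measurable V2 U2]
      integrable_norm_diff_power2[OF VM iterate_measurable V2 U2] by auto
  have B: "integrable P B"
    unfolding B_def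
    by (intro Bochner_Integration.integrable_add Bochner_Integration.integrable_diff
        integrable_mult_right integrable_divide_zero integrable_const i inc U2) 
  have le: "AE \<omega> in P. D (V \<omega>) (U (Suc k) \<omega>) \<le> B \<omega>"
    using R_le_Q[of k] AE_space
  proof eventually_elim
    case (elim \<omega>)
    then have "V \<omega> \<in> Uad" using V by (simp add: admissible_def)
    with elim show ?case
      using pathwise_step[of \<omega> "V \<omega>" k] by (simp add: B_def right_diff_distrib)
  qed
  show 1: "integrable P (\<lambda>\<omega>. D (V \<omega>) (U (Suc k) \<omega>))"
  proof (rule Bochner_Integration.integrable_bound[OF B])
    show "AE \<omega> in P. norm (D (V \<omega>) (U (Suc k) \<omega>)) \<le> norm (B \<omega>)"
      using le by eventually_elim (auto simp: bregman_nonneg intro: order_trans[OF _ abs_ge_self])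
  qed (rule bregman_measurable[OF VM iterate_measurable])
  have "(\<integral>\<omega>. D (V \<omega>) (U (Suc k) \<omega>) \<partial>P) \<le> (\<integral>\<omega>. B \<omega> \<partial>P)"
    by (rule integral_mono_AE[OF 1 B le])
  also have "\<dots> = (\<integral>\<omega>. D (V \<omega>) (U k \<omega>) \<partial>P)
      - eps k * (\<integral>\<omega>. (J (U k \<omega>) - J (V \<omega>)) \<partial>P)
      + noise k * (1 + (\<integral>\<omega>. (norm (V \<omega> - U k \<omega>))\<^sup>2 \<partial>P)
          + (2 * (c1 + d1)\<^sup>2 * (\<integral>\<omega>. (norm (U k \<omega>))\<^sup>2 \<partial>P) + 2 * (c2 + d2)\<^sup>2 + 1) / b)"
    unfolding B_def inc(3)[symmetric] using i inc(1) U2 by (simp add: prob_space)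
  finally show "(\<integral>\<omega>. D (V \<omega>) (U (Suc k) \<omega>) \<partial>P) \<le> (\<integral>\<omega>. D (V \<omega>) (U k \<omega>) \<partial>P)
      - eps k * (\<integral>\<omega>. (J (U k \<omega>) - J (V \<omega>)) \<partial>P)
      + noise k * (1 + (\<integral>\<omega>. (norm (V \<omega> - U k \<omega>))\<^sup>2 \<partial>P)
          + (2 * (c1 + d1)\<^sup>2 * (\<integral>\<omega>. (norm (U k \<omega>))\<^sup>2 \<partial>P) + 2 * (c2 + d2)\<^sup>2 + 1) / b)" .
qed

lemma norm_power2_le_bregman: "(norm u)\<^sup>2 \<le> 2 * (norm v)\<^sup>2 + 4 / b * D v u"
proof -
  have "(norm u)\<^sup>2 \<le> 2 * (norm v)\<^sup>2 + 2 * (norm (v - u))\<^sup>2"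
    using norm_diff_power2_le[of v "v - u"] by simp
  also have "2 * (norm (v - u))\<^sup>2 \<le> 4 / b * D v u"
    using bregman_lower[of v u] b_pos by (simp add: field_simps)
  finally show ?thesis by simp
qed

text \<open>Square integrability passes from \<open>U\<^sub>k\<close> to \<open>U\<^sub>k\<^sub>+\<^sub>1\<close> by the step inequality with the constant reference
  point \<open>u\<^sub>0\<close>, since \<open>D u\<^sub>0\<close> controls the squared norm.\<close>

lemma admissible_iterate: "admissible k (U k)"
proof (induction k)
  case 0
  have "integrable P (\<lambda>\<omega>. (norm (U 0 \<omega>))\<^sup>2) \<longleftrightarrow> integrable P (\<lambda>\<omega>. (norm u0)\<^sup>2)"
    by (intro Bochner_Integration.integrable_cong) (auto simp: U_init)
  then show ?case using U_adapted iterate_feasible by (simp add: admissible_def)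
next
  case (Suc k)
  have "integrable P (\<lambda>\<omega>. (norm (U (Suc k) \<omega>))\<^sup>2)"
  proof (rule Bochner_Integration.integrable_bound)
    show "integrable P (\<lambda>\<omega>. 2 * (norm u0)\<^sup>2 + 4 / b * D u0 (U (Suc k) \<omega>))"
      using expected_step(1)[OF admissible_const[OF u0_feasible] Suc] by simp
    show "AE \<omega> in P. norm ((norm (U (Suc k) \<omega>))\<^sup>2) \<le> norm (2 * (norm u0)\<^sup>2 + 4 / b * D u0 (U (Suc k) \<omega>))"
      using order_trans[OF norm_power2_le_bregman[of _ u0] abs_ge_self] by (intro AE_I2) simp
    show "(\<lambda>\<omega>. (norm (U (Suc k) \<omega>))\<^sup>2) \<in> borel_measurable P"
      using iterate_measurable[of "Suc k"] by measurable
  qed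
  then show ?case using U_adapted iterate_feasible by (auto simp: admissible_def)
qed

lemma iterate_square_integrable: "integrable P (\<lambda>\<omega>. (norm (U k \<omega>))\<^sup>2)"
  using admissible_iterate[of k] by (simp add: admissible_def)

definition gap :: "'u \<Rightarrow> nat \<Rightarrow> real" where
  "gap u k = (\<integral>\<omega>. (J (U k \<omega>) - J u) \<partial>P)"

lemma gap_integrable: "u \<in> Uad \<Longrightarrow> integrable P (\<lambda>\<omega>. J (U k \<omega>) - J u)"
  using expected_increment(2)[OF admissible_iterate admissible_const] .

lemma gap_nonneg:
  assumes "is_arg_min J (\<lambda>u. u \<in> Uad) u"
  shows "0 \<le> gap u k"
  unfolding gap_def
  using assms iterate_feasible by (intro integral_nonneg_AE AE_I2) (auto simp: is_arg_min_linorder)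

text \<open>With the minimizer as reference point, \<open>a\<^sub>k = \<E> (D u U\<^sub>k)\<close> dominates all second moments in the error term,
  so that \<open>expected_step\<close> becomes the recursion of \<open>perturbed_descent_bounded\<close>.\<close>

lemma moments_bounded:
  assumes min: "is_arg_min J (\<lambda>u. u \<in> Uad) u" and noise: "summable noise"
  shows "\<exists>M. \<forall>k. (\<integral>\<omega>. (norm (U k \<omega>))\<^sup>2 \<partial>P) \<le> M \<and> (\<Sum>i<k. eps i * gap u i) \<le> M"
proof -
  have u: "u \<in> Uad" using min by (simp add: is_arg_min_def)
  define a where "a k = (\<integral>\<omega>. D u (U k \<omega>) \<partial>P)" for k
  have ai: "integrable P (\<lambda>\<omega>. D u (U k \<omega>))" for k
    by (rule integrable_bregman) (auto intro: iterate_measurable iterate_square_integrable)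
  have a0: "0 \<le> a k" for k
    unfolding a_def by (intro integral_nonneg_AE AE_I2 bregman_nonneg)
  have m: "(\<integral>\<omega>. (norm (U k \<omega>))\<^sup>2 \<partial>P) \<le> 2 * (norm u)\<^sup>2 + 4 / b * a k" for k
  proof -
    have "(\<integral>\<omega>. (norm (U k \<omega>))\<^sup>2 \<partial>P) \<le> (\<integral>\<omega>. 2 * (norm u)\<^sup>2 + 4 / b * D u (U k \<omega>) \<partial>P)"
      using ai by (intro integral_mono norm_power2_le_bregman iterate_square_integrable) auto
    also have "\<dots> = 2 * (norm u)\<^sup>2 + 4 / b * a k" using ai by (simp add: a_def prob_space)
    finally show ?thesis .
  qed
  have d: "(\<integral>\<omega>. (norm (u - U k \<omega>))\<^sup>2 \<partial>P) \<le> 2 / b * a k" for k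
  proof -
    have "(\<integral>\<omega>. (norm (u - U k \<omega>))\<^sup>2 \<partial>P) \<le> (\<integral>\<omega>. 2 / b * D u (U k \<omega>) \<partial>P)"
    proof (intro integral_mono)
      show "integrable P (\<lambda>\<omega>. (norm (u - U k \<omega>))\<^sup>2)"
        by (rule integrable_norm_diff_power2) (auto intro: iterate_measurable iterate_square_integrable)
      show "(norm (u - U k \<omega>))\<^sup>2 \<le> 2 / b * D u (U k \<omega>)" for \<omega>
        using bregman_lower[of u "U k \<omega>"] b_pos by (simp add: field_simps)
    qed (use ai in auto)
    also have "\<dots> = 2 / b * a k" using ai by (simp add: a_def)
    finally show ?thesis .
  qed
  define A where "A = 2 * (c1 + d1)\<^sup>2"
  define C1 where "C1 = 1 + (A * (2 * (norm u)\<^sup>2) + 2 * (c2 + d2)\<^sup>2 + 1) / b"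
  define C2 where "C2 = 2 / b + A * (4 / b) / b"
  have A: "0 \<le> A" by (simp add: A_def)
  have C: "0 \<le> C1" "0 \<le> C2" using b_pos A by (simp_all add: C1_def C2_def)
  have "\<exists>M. \<forall>k. a k \<le> M \<and> (\<Sum>i<k. eps i * gap u i) \<le> M"
  proof (rule perturbed_descent_bounded[where C = "C1 + C2"])
    fix k
    show "0 \<le> eps k * gap u k" using eps_pos[of k] gap_nonneg[OF min, of k] by simp
    have "a (Suc k) \<le> a k - eps k * gap u k + noise k * (1 + (\<integral>\<omega>. (norm (u - U k \<omega>))\<^sup>2 \<partial>P)
          + (A * (\<integral>\<omega>. (norm (U k \<omega>))\<^sup>2 \<partial>P) + 2 * (c2 + d2)\<^sup>2 + 1) / b)"
      using expected_step(2)[OF admissible_const[OF u] admissible_iterate, of k]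
      by (simp add: a_def gap_def A_def)
    also have "\<dots> \<le> a k - eps k * gap u k + noise k * (1 + 2 / b * a k
          + (A * (2 * (norm u)\<^sup>2 + 4 / b * a k) + 2 * (c2 + d2)\<^sup>2 + 1) / b)"
      using b_pos A m d noise_nonneg
      by (intro add_mono mult_left_mono divide_right_mono order_refl) auto
    also have "1 + 2 / b * a k + (A * (2 * (norm u)\<^sup>2 + 4 / b * a k) + 2 * (c2 + d2)\<^sup>2 + 1) / b
        = C1 + C2 * a k"
      by (simp add: C1_def C2_def algebra_simps add_divide_distrib)
    also have "noise k * (C1 + C2 * a k) \<le> noise k * ((C1 + C2) * (1 + a k))"
      using C a0[of k] noise_nonneg[of k] by (intro mult_left_mono) (auto simp: algebra_simps)
    finally show "a (Suc k) \<le> a k - eps k * gap u k + (C1 + C2) * noise k * (1 + a k)"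
      by (simp add: ac_simps)
  qed (use a0 noise_nonneg noise C in auto)
  then obtain M where M: "\<And>k. a k \<le> M" "\<And>k. (\<Sum>i<k. eps i * gap u i) \<le> M" by auto
  show ?thesis
  proof (intro exI[of _ "2 * (norm u)\<^sup>2 + 4 / b * M + M"] allI conjI)
    fix k
    have M0: "0 \<le> M" using M(2)[of 0] by simp
    have "4 / b * a k \<le> 4 / b * M" using b_pos M(1)[of k] by (intro mult_left_mono) auto
    with m[of k] M0 show "(\<integral>\<omega>. (norm (U k \<omega>))\<^sup>2 \<partial>P) \<le> 2 * (norm u)\<^sup>2 + 4 / b * M + M" by linarith
    have "0 \<le> 4 / b * M" using b_pos M0 by simp
    with M(2)[of k] zero_le_power2[of "norm u"]
    show "(\<Sum>i<k. eps i * gap u i) \<le> 2 * (norm u)\<^sup>2 + 4 / b * M + M" by linarith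
  qed
qed

text \<open>The iterate \<open>U\<^sub>i\<close> is itself an admissible reference point at all later steps. Its divergence from itself
  is zero, so the telescoped sum from \<open>i\<close> to \<open>n\<close> leaves nothing but the error terms.\<close>

lemma tail_comparison:
  assumes u: "u \<in> Uad" and M: "\<And>k. (\<integral>\<omega>. (norm (U k \<omega>))\<^sup>2 \<partial>P) \<le> M"
  defines "C \<equiv> 1 + 4 * M + (2 * (c1 + d1)\<^sup>2 * M + 2 * (c2 + d2)\<^sup>2 + 1) / b"
  assumes i: "i \<le> n"
  shows "(\<Sum>k=i..n. eps k * (gap u k - gap u i)) \<le> (\<Sum>k=i..n. C * noise k)"
proof -
  define a where "a k = (\<integral>\<omega>. D (U i \<omega>) (U k \<omega>) \<partial>P)" for k
  have a0: "0 \<le> a k" for k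
    unfolding a_def by (intro integral_nonneg_AE AE_I2 bregman_nonneg)
  have step: "a (Suc k) \<le> a k - eps k * (gap u k - gap u i) + C * noise k" if k: "i \<le> k" for k
  proof -
    have "(\<integral>\<omega>. (J (U k \<omega>) - J (U i \<omega>)) \<partial>P) = (\<integral>\<omega>. (J (U k \<omega>) - J u) - (J (U i \<omega>) - J u) \<partial>P)"
      by simp
    also have "\<dots> = gap u k - gap u i"
      unfolding gap_def by (intro Bochner_Integration.integral_diff gap_integrable u)
    finally have g: "(\<integral>\<omega>. (J (U k \<omega>) - J (U i \<omega>)) \<partial>P) = gap u k - gap u i" .
    have "(\<integral>\<omega>. (norm (U i \<omega> - U k \<omega>))\<^sup>2 \<partial>P) \<le> (\<integral>\<omega>. 2 * (norm (U i \<omega>))\<^sup>2 + 2 * (norm (U k \<omega>))\<^sup>2 \<partial>P)"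
      by (intro integral_mono norm_diff_power2_le integrable_norm_diff_power2 iterate_measurable
          iterate_square_integrable Bochner_Integration.integrable_add integrable_mult_right)
    also have "\<dots> = 2 * (\<integral>\<omega>. (norm (U i \<omega>))\<^sup>2 \<partial>P) + 2 * (\<integral>\<omega>. (norm (U k \<omega>))\<^sup>2 \<partial>P)"
      by (simp add: iterate_square_integrable)
    also have "\<dots> \<le> 4 * M" using M[of i] M[of k] by linarith
    finally have d: "(\<integral>\<omega>. (norm (U i \<omega> - U k \<omega>))\<^sup>2 \<partial>P) \<le> 4 * M" .
    have "a (Suc k) \<le> a k - eps k * (gap u k - gap u i)
      + noise k * (1 + (\<integral>\<omega>. (norm (U i \<omega> - U k \<omega>))\<^sup>2 \<partial>P)
          + (2 * (c1 + d1)\<^sup>2 * (\<integral>\<omega>. (norm (U k \<omega>))\<^sup>2 \<partial>P) + 2 * (c2 + d2)\<^sup>2 + 1) / b)"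
      using expected_step(2)[OF admissible_mono[OF admissible_iterate k] admissible_iterate]
      by (simp add: a_def g)
    also have "\<dots> \<le> a k - eps k * (gap u k - gap u i) + noise k * C"
      unfolding C_def using b_pos noise_nonneg M d
      by (intro add_mono mult_left_mono divide_right_mono order_refl) auto
    finally show ?thesis by (simp add: mult.commute)
  qed
  have "a (Suc n) + (\<Sum>k=i..n. eps k * (gap u k - gap u i)) \<le> a i + (\<Sum>k=i..n. C * noise k)"
    using i
  proof (induction n rule: dec_induct)
    case base
    then show ?case using step[of i] by simp
  next
    case (step n)
    then show ?case using \<open>\<And>k. i \<le> k \<Longrightarrow> _\<close>[of "Suc n"] by simp
  qed
  moreover have "a i = 0" by (simp add: a_def bregman_def)
  ultimately show ?thesis using a0[of "Suc n"] by simp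
qed

theorem gap_rate:
  assumes min: "is_arg_min J (\<lambda>u. u \<in> Uad) u"
    and \<theta>: "1 / 2 < \<theta>" and \<nu>: "1 - \<theta> < \<nu>" and c: "0 < c" and q: "0 \<le> q"
    and eps: "\<And>k. k \<ge> 1 \<Longrightarrow> eps k = c * real k powr (- \<theta>)"
    and Q: "\<And>k. k \<ge> 1 \<Longrightarrow> Q k \<le> q * real k powr (- \<nu>)"
  shows "gap u \<in> O(\<lambda>n. real n powr (\<theta> - 1))"
proof -
  have u: "u \<in> Uad" using min by (simp add: is_arg_min_def)
  \<comment> \<open>The exponents \<open>2\<theta>\<close> and \<open>\<theta> + \<nu>\<close> are the decay rates of \<open>\<epsilon>\<^sub>k\<^sup>2\<close> and \<open>\<epsilon>\<^sub>k Q\<^sub>k\<close>.\<close>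
  define \<eta> where "\<eta> = min (2 * \<theta>) (\<theta> + \<nu>) - 1"
  have \<eta>: "\<eta> > 0" using \<theta> \<nu> by (simp add: \<eta>_def)
  define s where "s = c * q + c\<^sup>2 + (c * q)\<^sup>2"
  have s: "0 \<le> s" using c q by (simp add: s_def)
  have noise_le: "noise k \<le> s * real k powr (- (1 + \<eta>))" if k: "k \<ge> 1" for k
  proof -
    let ?p = "real k powr (- (1 + \<eta>))"
    have p: "real k powr (- x) \<le> ?p" if "1 + \<eta> \<le> x" for x
      using k that by (intro powr_mono) auto
    have "eps k * Q k \<le> (c * real k powr (- \<theta>)) * (q * real k powr (- \<nu>))"
      using eps[OF k] Q[OF k] c by (simp add: mult_left_mono)
    also have "\<dots> = c * q * real k powr (- (\<theta> + \<nu>))"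
      using powr_add[of "real k" "- \<theta>" "- \<nu>"] by simp
    also have "\<dots> \<le> c * q * ?p" using c q by (intro mult_left_mono p) (auto simp: \<eta>_def)
    finally have 1: "eps k * Q k \<le> c * q * ?p" .
    have "(eps k)\<^sup>2 = c\<^sup>2 * real k powr (- (2 * \<theta>))"
      using eps[OF k] powr_add[of "real k" "- \<theta>" "- \<theta>"] by (simp add: power2_eq_square)
    also have "\<dots> \<le> c\<^sup>2 * ?p" by (intro mult_left_mono p) (auto simp: \<eta>_def)
    finally have 2: "(eps k)\<^sup>2 \<le> c\<^sup>2 * ?p" .
    have p1: "?p \<le> 1" using powr_mono[of "- (1 + \<eta>)" 0 "real k"] k \<eta> by simp
    have "(eps k * Q k)\<^sup>2 \<le> (c * q * ?p)\<^sup>2"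
      using 1 eps_pos[of k] Q_nonneg[of k] by (intro power_mono) auto
    also have "\<dots> = (c * q)\<^sup>2 * (?p * ?p)" by (simp add: power2_eq_square)
    also have "\<dots> \<le> (c * q)\<^sup>2 * (?p * 1)" using p1 by (intro mult_left_mono) auto
    finally have 3: "(eps k * Q k)\<^sup>2 \<le> (c * q)\<^sup>2 * ?p" by simp
    from 1 2 3 show ?thesis by (simp add: noise_def s_def distrib_right)
  qed
  have "summable noise"
  proof (rule summable_comparison_test')
    show "summable (\<lambda>k. s * real k powr (- (1 + \<eta>)))"
      using \<eta> by (intro summable_mult) (simp add: summable_real_powr_iff)
    show "norm (noise k) \<le> s * real k powr (- (1 + \<eta>))" if "k \<ge> 1" for k
      using noise_le[OF that] noise_nonneg[of k] by simp
  qed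
  then obtain M where M: "\<And>k. (\<integral>\<omega>. (norm (U k \<omega>))\<^sup>2 \<partial>P) \<le> M" "\<And>k. (\<Sum>i<k. eps i * gap u i) \<le> M"
    using moments_bounded[OF min] by auto
  define C where "C = 1 + 4 * M + (2 * (c1 + d1)\<^sup>2 * M + 2 * (c2 + d2)\<^sup>2 + 1) / b"
  have "0 \<le> M" using M(2)[of 0] by simp
  then have C: "0 \<le> C" using b_pos by (simp add: C_def)
  show ?thesis
  proof (rule last_iterate_rate[OF c _ eps])
    show "0 \<le> gap u k" for k by (rule gap_nonneg[OF min])
    show "C * noise k \<le> (C * s) * real k powr (- (1 + \<eta>))" if "k \<ge> 1" for k
      using mult_left_mono[OF noise_le[OF that] C] by (simp add: mult.assoc)
    show "(\<Sum>k=i..n. eps k * (gap u k - gap u i)) \<le> (\<Sum>k=i..n. C * noise k)" if "i \<le> n" for i n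
      unfolding C_def by (rule tail_comparison[OF u M(1) that])
    show "(\<Sum>k=1..n. eps k * gap u k) \<le> M" for n
    proof -
      have "(\<Sum>k=1..n. eps k * gap u k) \<le> (\<Sum>k<Suc n. eps k * gap u k)"
        using eps_pos gap_nonneg[OF min] by (intro sum_mono2) (auto simp: less_imp_le)
      with M(2)[of "Suc n"] show ?thesis by linarith
    qed
  qed (use \<theta> \<eta> C s noise_nonneg in auto)
qed

end


section \<open>The rate of convergence\<close>

lemma (in app_convergent_run) error_sup_finite: "error_sup P R k < \<infinity>"
proof (rule ccontr)
  assume "\<not> error_sup P R k < \<infinity>"
  then have "error_sup P R k = top" by (metis infinity_ennreal_def less_top)
  then have "error_sup P R k * ennreal (eps k) = top"
    using eps_pos[of k] by (simp add: ennreal_top_mult)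
  moreover have "error_sup P R k * ennreal (eps k) \<le> (\<Sum>k. error_sup P R k * ennreal (eps k))"
    using sum_le_suminf[of "\<lambda>k. error_sup P R k * ennreal (eps k)" "{k}"] by simp
  ultimately show False using error_sup_summable by (simp add: top_unique)
qed

lemma (in app_convergent_run) norm_error_le_error_sup:
  "AE \<omega> in P. norm (R k \<omega>) \<le> enn2real (error_sup P R k)"
  using esssup_AE[of "\<lambda>\<omega>. ennreal (norm (R k \<omega>))" P]
proof eventually_elim
  case (elim \<omega>)
  then have "ennreal (norm (R k \<omega>)) \<le> error_sup P R k" by (simp add: error_sup_def)
  also have "\<dots> = ennreal (enn2real (error_sup P R k))"
    using error_sup_finite[of k] by simp
  finally show ?case by (simp add: ennreal_le_iff)
qed

theorem theorem4p7:
  fixes P :: "'a measure"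
    and Uad :: "'u::{banach, second_countable_topology} set"
    and jC jS :: "'u \<Rightarrow> 'w::{topological_ab_group_add, real_vector} \<Rightarrow> real"
    and K :: "'u \<Rightarrow> real"
    and gradK :: "'u \<Rightarrow> ('u \<Rightarrow>\<^sub>L real)"
    and W :: "'a \<Rightarrow> 'w"
    and c1 c2 d1 d2 b LK :: real
  defines "J \<equiv> expected_cost P jC jS W"
  assumes problem: "app_problem P Uad jC jS K gradK W"
    and a_consts: "c1 > 0" "c2 > 0" "d1 > 0" "d2 > 0"
    and a_jC: "\<And>u w r. u \<in> Uad \<Longrightarrow> r \<in> subdifferential (\<lambda>v. jC v w) u \<Longrightarrow>
                 norm r \<le> c1 * norm u + c2"
    and a_jS: "\<And>u w s. u \<in> Uad \<Longrightarrow> s \<in> subdifferential (\<lambda>v. jS v w) u \<Longrightarrow>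
                 norm s \<le> d1 * norm u + d2"
    and b_coercive: "coercive_on Uad J"
    and c_consts: "b > 0" "LK > 0"
    and c_strongly_convex:
      "\<And>u v. K v \<ge> K u + blinfun_apply (gradK u) (v - u) + b / 2 * (norm (u - v))\<^sup>2"
    and c_lipschitz: "\<And>u v. norm (gradK v - gradK u) \<le> LK * norm (v - u)"
  shows "(\<forall>\<theta> Ws eps R u0 G U usharp.
            1/2 < \<theta> \<and> \<theta> < 1 \<and>
            app_convergent_run P Uad jC jS K gradK W Ws eps R u0 G U \<and>
            polynomial_steps_and_errors P eps R \<theta> \<and>
            is_arg_min J (\<lambda>u. u \<in> Uad) usharp \<longrightarrow>
              (\<forall>n. integrable P (\<lambda>\<omega>. J (U n \<omega>) - J usharp)) \<and>
              (\<lambda>n. \<integral>\<omega>. (J (U n \<omega>) - J usharp) \<partial>P) \<in> O(\<lambda>n. real n powr (\<theta> - 1)))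
       \<and> (\<forall>\<delta>>0. \<forall>\<^sub>F \<theta> in at_right (1/2). \<forall>Ws eps R u0 G U usharp.
            app_convergent_run P Uad jC jS K gradK W Ws eps R u0 G U \<and>
            polynomial_steps_and_errors P eps R \<theta> \<and>
            is_arg_min J (\<lambda>u. u \<in> Uad) usharp \<longrightarrow>
              (\<lambda>n. \<integral>\<omega>. (J (U n \<omega>) - J usharp) \<partial>P) \<in> O(\<lambda>n. real n powr (- 1/2 + \<delta>)))"
proof -
  have kernel: "strongly_convex_kernel K gradK b LK"
    using c_consts c_strongly_convex c_lipschitz by unfold_locales auto
  have rate: "(\<forall>n. integrable P (\<lambda>\<omega>. J (U n \<omega>) - J usharp)) \<and>
      (\<lambda>n. \<integral>\<omega>. (J (U n \<omega>) - J usharp) \<partial>P) \<in> O(\<lambda>n. real n powr (\<theta> - 1))"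
    if \<theta>: "1 / 2 < \<theta>" "\<theta> < 1" and run: "app_convergent_run P Uad jC jS K gradK W Ws eps R u0 G U"
      and poly: "polynomial_steps_and_errors P eps R \<theta>"
      and min: "is_arg_min J (\<lambda>u. u \<in> Uad) usharp"
    for \<theta> Ws eps R u0 G U usharp
  proof -
    interpret run: app_convergent_run P Uad jC jS K gradK W Ws eps R u0 G U by (rule run)
    define Q where "Q k = enn2real (error_sup P R k)" for k
    interpret app_bounded_errors P Uad jC jS K gradK W Ws eps R u0 G U b LK c1 c2 d1 d2 Q
      using a_consts a_jC a_jS kernel run.app_algorithm_axioms run.norm_error_le_error_sup
      by (intro app_bounded_errors.intro app_bounded_errors_axioms.intro)
        (auto simp: Q_def less_imp_le)
    obtain c q \<nu> where c: "c > 0" "\<And>k. k \<ge> 1 \<Longrightarrow> eps k = c * real k powr (- \<theta>)"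
      and q: "q > 0" and \<nu>: "\<nu> > 1 - \<theta>"
      and sup: "\<And>k. k \<ge> 1 \<Longrightarrow> error_sup P R k \<le> ennreal (q * real k powr (- \<nu>))"
      using poly unfolding polynomial_steps_and_errors_def by auto
    have "Q k \<le> q * real k powr (- \<nu>)" if "k \<ge> 1" for k
      using enn2real_mono[OF sup[OF that]] q by (simp add: Q_def)
    with \<theta> c q \<nu> min have "gap usharp \<in> O(\<lambda>n. real n powr (\<theta> - 1))"
      unfolding J_def by (intro gap_rate[where c = c and q = q and \<nu> = \<nu>]) auto
    moreover have "usharp \<in> Uad" using min by (simp add: is_arg_min_def)
    ultimately show ?thesis unfolding J_def gap_def[abs_def] using gap_integrable by auto
  qed
  show ?thesis
  proof (intro conjI allI impI)
    fix \<delta> :: real assume \<delta>: "\<delta> > 0"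
    have "\<forall>\<^sub>F \<theta> in at_right (1 / 2). \<theta> \<in> {1 / 2<..<min 1 (1 / 2 + \<delta>)}"
      using \<delta> by (intro eventually_at_right_real) simp
    then show "\<forall>\<^sub>F \<theta> in at_right (1/2). \<forall>Ws eps R u0 G U usharp.
            app_convergent_run P Uad jC jS K gradK W Ws eps R u0 G U \<and>
            polynomial_steps_and_errors P eps R \<theta> \<and>
            is_arg_min J (\<lambda>u. u \<in> Uad) usharp \<longrightarrow>
              (\<lambda>n. \<integral>\<omega>. (J (U n \<omega>) - J usharp) \<partial>P) \<in> O(\<lambda>n. real n powr (- 1/2 + \<delta>))"
    proof eventually_elim
      case (elim \<theta>)
      then have \<theta>: "1 / 2 < \<theta>" "\<theta> < 1" "\<theta> - 1 \<le> - 1 / 2 + \<delta>" by auto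
      have "(\<lambda>n. real n powr (\<theta> - 1)) \<in> O(\<lambda>n. real n powr (- 1/2 + \<delta>))"
      proof (rule bigoI[of _ 1])
        show "\<forall>\<^sub>F n in sequentially. norm (real n powr (\<theta> - 1)) \<le> 1 * norm (real n powr (- 1/2 + \<delta>))"
          using eventually_ge_at_top[of 1] by eventually_elim (use \<theta>(3) in \<open>simp add: powr_mono\<close>)
      qed
      then show ?case using rate[OF \<theta>(1,2)] by (blast intro: landau_o.big.trans)
    qed
  qed (use rate in blast)+
qed

end
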